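(* Let $G$ be a forest without isolated vertices on $n$ vertices. Then $c_k=1-h_k^+$ for all $k=1,\dots,n$.
   Context: $d_i$ degree, $\mathrm{vol}(S)=\sum_{i\in S}d_i$, $|E(A,B)|$ number of edges between $A$ and $B$. $I^+(\vec x)=\sum_{\{i,j\}\in E}|x_i+x_j|$, $X=\{\vec x:\sum_i d_i|x_i|=1\}$, $c_k=\inf\{\sup_{\vec x\in A}I^+(\vec x): A\subseteq X\text{ compact}, A=-A,\gamma(A)\ge k\}$ (min-max eigenvalues of the signless 1-Laplacian), $\gamma$ the Krasnoselskii genus. $h_k^+=\max\min_{1\le i\le k}\frac{2|E(V_{2i-1},V_{2i})|}{\mathrm{vol}(V_{2i-1}\cup V_{2i})}$ over pairwise disjoint $V_1,\dots,V_{2k}\subseteq V$ with $V_{2i-1}\cup V_{2i}\neq\emptyset$. *)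

theory Defs
  imports "HOL-Analysis.Analysis" "HOL-Library.Extended_Nat"
begin

text \<open>
  A finite simple graph is given by its edge set; the vertex set is the whole finite type
  \<open>'v\<close>, so the number of vertices is \<open>CARD('v)\<close> and \<open>real ^ 'v\<close> is the space of real
  functions on the vertices.
\<close>

definition simple_graph :: "'v set set \<Rightarrow> bool" where
  "simple_graph E \<longleftrightarrow> (\<forall>e\<in>E. card e = 2)"

text \<open>A cycle is listed without repeating its starting vertex.\<close>

definition is_cycle :: "'v set set \<Rightarrow> 'v list \<Rightarrow> bool" where
  "is_cycle E vs \<longleftrightarrow> 3 \<le> length vs \<and> distinct vs \<and>
     (\<forall>i<length vs. {vs ! i, vs ! (Suc i mod length vs)} \<in> E)"

definition forest :: "'v set set \<Rightarrow> bool" where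
  "forest E \<longleftrightarrow> simple_graph E \<and> (\<nexists>vs. is_cycle E vs)"

definition isolated :: "'v set set \<Rightarrow> 'v \<Rightarrow> bool" where
  "isolated E i \<longleftrightarrow> (\<forall>e\<in>E. i \<notin> e)"

definition degree :: "'v set set \<Rightarrow> 'v \<Rightarrow> nat" where
  "degree E i = card {e \<in> E. i \<in> e}"

definition vol :: "'v set set \<Rightarrow> 'v set \<Rightarrow> nat" where
  "vol E S = (\<Sum>i\<in>S. degree E i)"

definition edges_between :: "'v set set \<Rightarrow> 'v set \<Rightarrow> 'v set \<Rightarrow> 'v set set" where
  "edges_between E A B = {e \<in> E. \<exists>a\<in>A. \<exists>b\<in>B. e = {a, b}}"

text \<open>
  For an edge \<open>e = {i, j}\<close> with \<open>i \<noteq> j\<close>, the inner sum is \<open>x\<^sub>i + x\<^sub>j\<close>.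
\<close>

definition I_plus :: "'v set set \<Rightarrow> real ^ 'v::finite \<Rightarrow> real" where
  "I_plus E x = (\<Sum>e\<in>E. \<bar>\<Sum>i\<in>e. x $ i\<bar>)"

definition X :: "'v set set \<Rightarrow> (real ^ 'v::finite) set" where
  "X E = {x. (\<Sum>i\<in>UNIV. real (degree E i) * \<bar>x $ i\<bar>) = 1}"

text \<open>
  Krasnoselskii genus of a symmetric set: the least \<open>m \<ge> 1\<close> admitting an odd continuous map
  into the sphere of dimension \<open>m - 1\<close> in Euclidean \<open>m\<close>-space; it is \<open>\<infinity>\<close> (the infimum of the
  empty set) if there is no such \<open>m\<close>, and \<open>0\<close> for the empty set.
\<close>

definition genus :: "'a::real_normed_vector set \<Rightarrow> enat" where
  "genus A = (if A = {} then 0 else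
     Inf {enat m |m. 1 \<le> m \<and>
       (\<exists>h. continuous_map (top_of_set A) (nsphere (m - 1)) h \<and>
            (\<forall>x\<in>A. h (- x) = (\<lambda>i. - h x i)))})"

definition minmax_eigenvalue :: "'v::finite set set \<Rightarrow> nat \<Rightarrow> real" where
  "minmax_eigenvalue E k =
     (INF A\<in>{A. A \<subseteq> X E \<and> compact A \<and> A = uminus ` A \<and> enat k \<le> genus A}.
        SUP x\<in>A. I_plus E x)"

text \<open>
  The families \<open>V\<^sub>1, \<dots>, V\<^sub>2\<^sub>k\<close> competing in \<open>h\<^sub>k\<^sup>+\<close>; only the values of \<open>V\<close> on
  \<open>{1..2 * k}\<close> matter.
\<close>

definition admissible :: "nat \<Rightarrow> (nat \<Rightarrow> 'v set) \<Rightarrow> bool" where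
  "admissible k V \<longleftrightarrow> disjoint_family_on V {1..2 * k} \<and>
     (\<forall>i\<in>{1..k}. V (2 * i - 1) \<union> V (2 * i) \<noteq> {})"

definition h_plus :: "'v::finite set set \<Rightarrow> nat \<Rightarrow> real" where
  "h_plus E k =
     Max {(MIN i\<in>{1..k}.
             2 * real (card (edges_between E (V (2 * i - 1)) (V (2 * i)))) /
             real (vol E (V (2 * i - 1) \<union> V (2 * i)))) |V. admissible k V}"

end

theory Submission
  imports Defs "HOL-Homology.Homology"
begin

text \<open>
  For disjoint \<open>A\<close>, \<open>B\<close> the signed indicator \<open>u = 1\<^sub>A - 1\<^sub>B\<close> satisfies \<open>I\<^sup>+(u) = vol(A \<union> B) - 2|E(A, B)|\<close>.
  Hence the signed indicators of an optimal family span a \<open>k\<close>-dimensional space on which \<open>I\<^sup>+\<close> is at most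
  \<open>1 - h\<^sub>k\<^sup>+\<close> times the norm; by Borsuk-Ulam the unit sphere of this space has genus at least \<open>k\<close>, which gives
  \<open>c\<^sub>k \<le> 1 - h\<^sub>k\<^sup>+\<close>.

  Conversely let \<open>\<theta> > h\<^sub>k\<^sup>+\<close>. Among the connected supports of pairs with ratio at least \<open>\<theta>\<close> no \<open>k\<close> are
  disjoint, and connected subsets of a forest have the packing-covering (Koenig) property, so fewer than
  \<open>k\<close> vertices meet all of them. By the coarea formula every \<open>x\<close> in \<open>X\<close> with \<open>I\<^sup>+(x) \<le> 1 - \<theta>\<close> is nonzero at
  one of these vertices, and restricting \<open>x\<close> to them bounds the genus of a competitor below \<open>k\<close>.

  Borsuk-Ulam follows from the oddness of the degree of odd sphere maps: approximate by an odd smooth map,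
  whose restriction to the equator misses a pair of antipodes, push the equator away from that pair into
  the equator, and use that the degrees on the sphere and on its equator have the same parity.
\<close>

section \<open>Connected subsets of a forest\<close>

text \<open>Connectedness of the induced subgraph, in terms of cuts instead of paths. The empty set
  qualifies, so nonemptiness is always required separately.\<close>

definition conn :: "'v set set \<Rightarrow> 'v set \<Rightarrow> bool" where
  "conn E C \<longleftrightarrow> (\<forall>P. P \<subset> C \<and> P \<noteq> {} \<longrightarrow> (\<exists>a\<in>P. \<exists>b\<in>C - P. {a, b} \<in> E))"

lemma connE:
  assumes "conn E C" "P \<subset> C" "P \<noteq> {}"
  obtains a b where "a \<in> P" "b \<in> C" "b \<notin> P" "{a, b} \<in> E"
  using assms unfolding conn_def by (metis DiffE)

text \<open>A cut of \<open>C - {l}\<close> becomes a cut of \<open>C\<close> by putting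
  \<open>l\<close> on the side of \<open>p\<close>. The edge that then crosses cannot be the one
  between \<open>l\<close> and \<open>p\<close>, so it avoids \<open>l\<close>.\<close>

lemma conn_remove_leaf:
  assumes C: "conn E C" and leaf: "\<And>w. w \<in> C \<Longrightarrow> {l, w} \<in> E \<Longrightarrow> w = p"
  shows "conn E (C - {l})"
proof (cases "l \<in> C")
  case False
  then show ?thesis using C by simp
next
  case True
  show ?thesis
    unfolding conn_def
  proof (intro allI impI; elim conjE)
    fix P assume P: "P \<subset> C - {l}" "P \<noteq> {}"
    show "\<exists>a\<in>P. \<exists>b\<in>C - {l} - P. {a, b} \<in> E"
    proof (cases "p \<in> P")
      case True
      have "insert l P \<subset> C" "insert l P \<noteq> {}" using P \<open>l \<in> C\<close> by auto
      then obtain a b where ab: "a \<in> insert l P" "b \<in> C" "b \<notin> insert l P" "{a, b} \<in> E"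
        by (rule connE[OF C])
      have "a \<noteq> l" using ab leaf[of b] True by auto
      then show ?thesis using ab by blast
    next
      case False
      have "P \<subset> C" using P by auto
      then obtain a b where ab: "a \<in> P" "b \<in> C" "b \<notin> P" "{a, b} \<in> E"
        using connE[OF C _ P(2)] by metis
      have "b \<noteq> l" using ab leaf[of a] False P by (auto simp: insert_commute)
      then show ?thesis using ab by blast
    qed
  qed
qed

text \<open>The first vertex of a longest path in \<open>W\<close> works: its neighbours in
  \<open>W\<close> all lie on the path, and one beyond the second position closes a cycle. If it has
  no neighbour in \<open>W\<close>, any \<open>p\<close> serves.\<close>

lemma forest_leaf:
  assumes E: "forest E" and W: "finite W" "W \<noteq> {}"
  shows "\<exists>l\<in>W. \<exists>p. \<forall>w\<in>W. {l, w} \<in> E \<longrightarrow> w = p"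
proof (rule ccontr)
  assume no_leaf: "\<not> ?thesis"
  define path where "path vs \<longleftrightarrow> vs \<noteq> [] \<and> distinct vs \<and> set vs \<subseteq> W \<and>
    (\<forall>i. Suc i < length vs \<longrightarrow> {vs ! i, vs ! Suc i} \<in> E)" for vs
  obtain w0 where "w0 \<in> W" using W by blast
  then have "path [w0]" by (simp add: path_def)
  moreover have "\<forall>vs. path vs \<longrightarrow> length vs < Suc (card W)"
    using W unfolding path_def by (metis card_mono distinct_card less_Suc_eq_le)
  ultimately have "\<exists>vs. path vs \<and> (\<forall>us. path us \<longrightarrow> length us \<le> length vs)"
    by (rule ex_has_greatest_nat)
  then obtain vs where vs: "path vs" and maxl: "\<And>us. path us \<Longrightarrow> length us \<le> length vs" by blast
  define l where "l = vs ! 0"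
  have l: "l \<in> W" using vs by (auto simp: path_def l_def)
  have on_path: "\<exists>j. j < length vs \<and> w = vs ! j \<and> j \<noteq> 0" if "w \<in> W" "{l, w} \<in> E" for w
  proof -
    have "w \<noteq> l" using that E unfolding forest_def simple_graph_def by force
    \<comment> \<open>Otherwise \<open>w\<close> could be prepended to the path, against
      maximality.\<close>
    moreover have "w \<in> set vs"
    proof (rule ccontr)
      assume "w \<notin> set vs"
      then have "path (w # vs)"
        using vs that unfolding path_def l_def
        by (auto simp: nth_Cons insert_commute split: nat.split)
      then show False using maxl by fastforce
    qed
    ultimately show ?thesis unfolding l_def by (metis in_set_conv_nth)
  qed
  obtain w where w: "w \<in> W" "{l, w} \<in> E" using no_leaf l by blast
  obtain w' where w': "w' \<in> W" "{l, w'} \<in> E" "w' \<noteq> w" using no_leaf l by blast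
  \<comment> \<open>Two distinct neighbours sit at distinct nonzero positions, so one position is at
    least 2. The initial segment up to it then has at least three vertices, as a cycle must.\<close>
  obtain j where j: "j < length vs" "{l, vs ! j} \<in> E" "2 \<le> j"
  proof -
    obtain i where i: "i < length vs" "w = vs ! i" "i \<noteq> 0" using on_path[OF w] by blast
    obtain i' where i': "i' < length vs" "w' = vs ! i'" "i' \<noteq> 0" using on_path[OF w'(1,2)] by blast
    have "i \<noteq> i'" using w'(3) i i' by metis
    then have "2 \<le> i \<or> 2 \<le> i'" using i(3) i'(3) by linarith
    then show ?thesis using that[of i] that[of i'] w(2) w'(2) i(1,2) i'(1,2) by metis
  qed
  have "is_cycle E (take (Suc j) vs)"
    unfolding is_cycle_def
  proof (intro conjI allI impI)
    show "3 \<le> length (take (Suc j) vs)" using j by simp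
    show "distinct (take (Suc j) vs)" using vs by (simp add: path_def)
    fix i assume i: "i < length (take (Suc j) vs)"
    show "{take (Suc j) vs ! i, take (Suc j) vs ! (Suc i mod length (take (Suc j) vs))} \<in> E"
    proof (cases "i = j")
      case True
      then show ?thesis using j by (simp add: l_def insert_commute min_absorb2)
    next
      case False
      then have "Suc i < Suc j" using i by simp
      then show ?thesis using i j vs by (simp add: path_def min_absorb2)
    qed
  qed
  then show False using E by (auto simp: forest_def)
qed

text \<open>Induction on \<open>W\<close>, removing a leaf \<open>l\<close>. If \<open>{l}\<close>
  belongs to \<open>F\<close>, then \<open>l\<close> joins the hitting set, \<open>{l}\<close> joins
  the packing, and the members avoiding \<open>l\<close> are left. Otherwise \<open>l\<close> is
  deleted from every member, and the packing found is lifted back.\<close>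

lemma forest_packing_covering:
  assumes E: "forest E" and "finite W" and "\<forall>C\<in>F. C \<subseteq> W \<and> C \<noteq> {} \<and> conn E C"
  shows "\<exists>H M. H \<subseteq> W \<and> M \<subseteq> F \<and> disjoint M \<and> finite M \<and> card H = card M \<and> (\<forall>C\<in>F. C \<inter> H \<noteq> {})"
  using assms(2,3)
proof (induction W arbitrary: F rule: finite_psubset_induct)
  case (psubset W)
  note F = bspec[OF psubset.prems]
  show ?case
  proof (cases "W = {}")
    case True
    then have "F = {}" using psubset.prems by blast
    then show ?thesis by (intro exI[of _ "{}"]) auto
  next
    case False
    then obtain l p where l: "l \<in> W" and leaf: "\<And>w. w \<in> W \<Longrightarrow> {l, w} \<in> E \<Longrightarrow> w = p"
      using forest_leaf[OF E psubset.hyps] by blast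
    have sub: "W - {l} \<subset> W" using l by auto
    show ?thesis
    proof (cases "{l} \<in> F")
      case True
      have "\<forall>C \<in> {C \<in> F. l \<notin> C}. C \<subseteq> W - {l} \<and> C \<noteq> {} \<and> conn E C"
        using psubset.prems by blast
      from psubset.IH[OF sub this] obtain H M where HM: "H \<subseteq> W - {l}" "M \<subseteq> {C \<in> F. l \<notin> C}"
        "disjoint M" "finite M" "card H = card M" "\<forall>C\<in>{C \<in> F. l \<notin> C}. C \<inter> H \<noteq> {}"
        by (elim exE conjE) (rule that)
      have "finite H" by (rule finite_subset[OF HM(1)]) (simp add: psubset.hyps)
      have "l \<notin> H" "{l} \<notin> M" using HM(1,2) by auto
      have "disjoint (insert {l} M)"
        using HM(2,3) by (auto simp: pairwise_insert disjnt_def)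
      moreover have "card (insert l H) = card (insert {l} M)"
        using HM \<open>finite H\<close> \<open>l \<notin> H\<close> \<open>{l} \<notin> M\<close> by simp
      moreover have "\<forall>C\<in>F. C \<inter> insert l H \<noteq> {}" using HM(6) by auto
      ultimately show ?thesis using HM(1,2,4) True l
        by (intro exI[of _ "insert l H"] exI[of _ "insert {l} M"]) auto
    next
      case False
      have "\<forall>C' \<in> (\<lambda>C. C - {l}) ` F. C' \<subseteq> W - {l} \<and> C' \<noteq> {} \<and> conn E C'"
      proof (clarify; intro conjI)
        fix C assume C: "C \<in> F"
        show "C - {l} \<subseteq> W - {l}" using F[OF C] by auto
        show "C - {l} \<noteq> {}" using F[OF C] False C by (metis insert_Diff_single Diff_eq_empty_iff subset_singletonD)
        show "conn E (C - {l})" using conn_remove_leaf[of E C l p] F[OF C] leaf by blast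
      qed
      from psubset.IH[OF sub this] obtain H M where HM: "H \<subseteq> W - {l}" "M \<subseteq> (\<lambda>C. C - {l}) ` F"
        "disjoint M" "finite M" "card H = card M" "\<forall>C\<in>(\<lambda>C. C - {l}) ` F. C \<inter> H \<noteq> {}"
        by (elim exE conjE) (rule that)
      have "\<forall>C\<in>M. \<exists>D. D \<in> F \<and> C = D - {l}" using HM(2) by auto
      from bchoice[OF this] obtain g where g: "\<And>C. C \<in> M \<Longrightarrow> g C \<in> F \<and> C = g C - {l}"
        by auto
      have inj: "inj_on g M" using g by (metis inj_onI)
      \<comment> \<open>A member of \<open>F\<close> that contains \<open>l\<close> has another
        vertex, and by connectedness it contains the only neighbour \<open>p\<close> of
        \<open>l\<close>. Two lifts sharing \<open>l\<close> would therefore already share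
        \<open>p\<close> before lifting.\<close>
      have p_in: "p \<in> C" if C: "C \<in> M" "l \<in> g C" for C
      proof -
        have "{l} \<subset> g C" using g[OF C(1)] False C by auto
        then obtain b where "b \<in> g C" "b \<noteq> l" "{l, b} \<in> E"
          using F[of "g C"] g[OF C(1)] connE[of E "g C" "{l}"] by (metis insert_not_empty singletonD singletonI)
        then show ?thesis using leaf[of b] F[of "g C"] g[OF C(1)] by blast
      qed
      have "disjoint (g ` M)"
      proof (rule pairwise_imageI)
        fix C D assume CD: "C \<in> M" "D \<in> M" "C \<noteq> D"
        then have disj: "C \<inter> D = {}" using HM(3) by (auto simp: pairwise_def disjnt_def)
        have "l \<notin> g C \<inter> g D" using p_in CD disj by blast
        then show "disjnt (g C) (g D)"
          using disj g[OF CD(1)] g[OF CD(2)] unfolding disjnt_def by blast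
      qed
      moreover have "\<forall>C\<in>F. C \<inter> H \<noteq> {}"
      proof
        fix C assume "C \<in> F"
        then have "(C - {l}) \<inter> H \<noteq> {}" using HM(6) by simp
        then show "C \<inter> H \<noteq> {}" by auto
      qed
      moreover have "card H = card (g ` M)" using HM(5) inj by (simp add: card_image)
      ultimately show ?thesis using HM(1,4) g
        by (intro exI[of _ H] exI[of _ "g ` M"]) auto
    qed
  qed
qed

section \<open>Tight pairs and hitting sets\<close>

definition wnorm :: "'v set set \<Rightarrow> real ^ 'v::finite \<Rightarrow> real" where
  "wnorm E x = (\<Sum>i\<in>UNIV. real (degree E i) * \<bar>x $ i\<bar>)"

text \<open>The cancellation along an edge: for \<open>e = {i, j}\<close> with
  \<open>i \<noteq> j\<close> it is twice the smaller of the two absolute values if the signs are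
  opposite, and 0 otherwise.\<close>

definition gain :: "real ^ 'v::finite \<Rightarrow> 'v set \<Rightarrow> real" where
  "gain x e = (\<Sum>i\<in>e. \<bar>x $ i\<bar>) - \<bar>\<Sum>i\<in>e. x $ i\<bar>"

definition sign_vec :: "'v set \<Rightarrow> 'v set \<Rightarrow> real ^ 'v::finite" where
  "sign_vec A B = (\<chi> i. if i \<in> A then 1 else if i \<in> B then - 1 else 0)"

lemma degree_sum:
  fixes E :: "'v::finite set set" and w :: "'v \<Rightarrow> real"
  shows "(\<Sum>i\<in>UNIV. real (degree E i) * w i) = (\<Sum>e\<in>E. \<Sum>i\<in>e. w i)"
proof -
  have "(\<Sum>i\<in>UNIV. real (degree E i) * w i) = (\<Sum>i\<in>UNIV. \<Sum>e\<in>E. if i \<in> e then w i else 0)"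
    by (simp add: Defs.degree_def sum.If_cases Int_def)
  also have "\<dots> = (\<Sum>e\<in>E. \<Sum>i\<in>UNIV. if i \<in> e then w i else 0)"
    by (rule sum.swap)
  also have "\<dots> = (\<Sum>e\<in>E. \<Sum>i\<in>e. w i)"
    by (simp add: sum.If_cases)
  finally show ?thesis .
qed

lemma wnorm_minus_I_plus: "wnorm E x - I_plus E x = (\<Sum>e\<in>E. gain x e)"
  unfolding wnorm_def I_plus_def gain_def by (simp add: degree_sum sum_subtractf)

lemma wnorm_sign_vec:
  assumes "A \<inter> B = {}"
  shows "wnorm E (sign_vec A B) = real (vol E (A \<union> B))"
proof -
  have "\<bar>sign_vec A B $ i\<bar> = (if i \<in> A \<union> B then 1 else 0)" for i
    by (simp add: sign_vec_def)
  then show ?thesis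
    by (simp add: wnorm_def vol_def if_distrib[of "(*) _"] sum.If_cases Un_def cong: if_cong)
qed

lemma gain_sign_vec:
  assumes "simple_graph E" "e \<in> E" "A \<inter> B = {}"
  shows "gain (sign_vec A B) e = (if e \<in> edges_between E A B then 2 else 0)"
proof -
  obtain i j where e: "e = {i, j}" "i \<noteq> j"
    using assms(1,2) by (auto simp: simple_graph_def card_2_iff)
  have "e \<in> edges_between E A B \<longleftrightarrow> i \<in> A \<and> j \<in> B \<or> i \<in> B \<and> j \<in> A"
    using assms(2) e by (auto simp: edges_between_def doubleton_eq_iff)
  then show ?thesis using e assms(3) by (auto simp: gain_def sign_vec_def)
qed

lemma sum_gain_sign_vec:
  assumes "simple_graph E" "A \<inter> B = {}"
  shows "(\<Sum>e\<in>E. gain (sign_vec A B) e) = 2 * real (card (edges_between E A B))"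
proof -
  have "(\<Sum>e\<in>E. gain (sign_vec A B) e) = (\<Sum>e\<in>E. if e \<in> edges_between E A B then 2 else 0)"
    using gain_sign_vec[OF assms(1) _ assms(2)] by (intro sum.cong) auto
  also have "\<dots> = 2 * real (card (E \<inter> edges_between E A B))"
    by (simp add: sum.If_cases)
  also have "E \<inter> edges_between E A B = edges_between E A B" by (auto simp: edges_between_def)
  finally show ?thesis .
qed

lemma I_plus_sign_vec:
  assumes "simple_graph E" "A \<inter> B = {}"
  shows "I_plus E (sign_vec A B) = real (vol E (A \<union> B)) - 2 * real (card (edges_between E A B))"
  using wnorm_minus_I_plus[of E "sign_vec A B"] wnorm_sign_vec[OF assms(2), of E]
    sum_gain_sign_vec[OF assms] by linarith

section \<open>The discrete coarea inequality\<close>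

lemma abs_peel_layer:
  fixes a t :: real
  assumes "0 \<le> t" "a \<noteq> 0 \<Longrightarrow> t \<le> \<bar>a\<bar>"
  shows "\<bar>a\<bar> = t * \<bar>sgn a\<bar> + \<bar>a - t * sgn a\<bar>"
  using assms by (auto simp: sgn_real_def)

text \<open>Since \<open>t\<close> does not exceed the nonzero absolute values, peeling reverses no
  sign. For equal signs all terms have one sign and add up; for opposite signs the two layers
  cancel.\<close>

lemma abs_add_peel_layer:
  fixes a b t :: real
  assumes "0 \<le> t" "a \<noteq> 0 \<Longrightarrow> t \<le> \<bar>a\<bar>" "b \<noteq> 0 \<Longrightarrow> t \<le> \<bar>b\<bar>"
  shows "\<bar>a + b\<bar> = t * \<bar>sgn a + sgn b\<bar> + \<bar>(a - t * sgn a) + (b - t * sgn b)\<bar>"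
  using assms by (cases a "0::real" rule: linorder_cases; cases b "0::real" rule: linorder_cases) auto

text \<open>A discrete coarea argument: peel off the layers \<open>t \<cdot> sgn x\<close> of \<open>x\<close>.\<close>
lemma layer_cake:
  fixes x :: "real ^ 'v::finite"
  assumes G: "simple_graph E"
    and small: "\<And>A B. A \<inter> B = {} \<Longrightarrow> A \<union> B \<noteq> {} \<Longrightarrow> A \<union> B \<subseteq> {i. x $ i \<noteq> 0} \<Longrightarrow>
        2 * real (card (edges_between E A B)) < \<theta> * real (vol E (A \<union> B))"
    and "x \<noteq> 0"
  shows "(\<Sum>e\<in>E. gain x e) < \<theta> * wnorm E x"
proof -
  \<comment> \<open>The weak inequality for all vectors is included because the remainder after
    peeling may be zero.\<close>
  have "(\<Sum>e\<in>E. gain x e) \<le> \<theta> * wnorm E x \<and> (x \<noteq> 0 \<longrightarrow> (\<Sum>e\<in>E. gain x e) < \<theta> * wnorm E x)"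
    using small
  proof (induction "card {i. x $ i \<noteq> 0}" arbitrary: x rule: less_induct)
    case less
    show ?case
    proof (cases "x = 0")
      case True
      then show ?thesis by (simp add: gain_def wnorm_def)
    next
      case False
      define S where "S = {i. x $ i \<noteq> 0}"
      have S: "S \<noteq> {}" using False by (auto simp: S_def vec_eq_iff)
      \<comment> \<open>With the least nonzero absolute value as height, peeling annihilates the
        entry where it is attained, so the support shrinks strictly.\<close>
      define t where "t = Min ((\<lambda>i. \<bar>x $ i\<bar>) ` S)"
      have "t \<in> (\<lambda>i. \<bar>x $ i\<bar>) ` S" unfolding t_def using S by (intro Min_in) auto
      then obtain m where m: "m \<in> S" "t = \<bar>x $ m\<bar>" by auto
      have t0: "0 < t" using m by (simp add: S_def)
      have t: "t \<le> \<bar>x $ i\<bar>" if "x $ i \<noteq> 0" for i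
        unfolding t_def using that by (intro Min_le) (auto simp: S_def)
      define A B where "A = {i. 0 < x $ i}" and "B = {i. x $ i < 0}"
      have AB: "A \<inter> B = {}" "A \<union> B = S" by (auto simp: A_def B_def S_def)
      define u where "u = sign_vec A B"
      have u: "u $ i = sgn (x $ i)" for i
        by (auto simp: u_def sign_vec_def A_def B_def sgn_real_def)
      define y where "y = x - t *\<^sub>R u"
      have y: "y $ i = x $ i - t * sgn (x $ i)" for i by (simp add: y_def u)
      have abs_x: "\<bar>x $ i\<bar> = t * \<bar>u $ i\<bar> + \<bar>y $ i\<bar>" for i
        unfolding u y using abs_peel_layer[of t "x $ i"] t0 t[of i] by simp
      have norm_x: "wnorm E x = t * wnorm E u + wnorm E y"
        by (simp add: wnorm_def abs_x distrib_left sum.distrib sum_distrib_left mult_ac)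
      have gain_x: "gain x e = t * gain u e + gain y e" if e: "e \<in> E" for e
      proof -
        obtain i j where ij: "e = {i, j}" "i \<noteq> j"
          using G e by (auto simp: simple_graph_def card_2_iff)
        have "\<bar>x $ i + x $ j\<bar> = t * \<bar>u $ i + u $ j\<bar> + \<bar>y $ i + y $ j\<bar>"
          unfolding u y using abs_add_peel_layer[of t "x $ i" "x $ j"] t0 t[of i] t[of j] by simp
        then show ?thesis using ij abs_x[of i] abs_x[of j] by (simp add: gain_def algebra_simps)
      qed
      have sum_x: "(\<Sum>e\<in>E. gain x e) = t * (\<Sum>e\<in>E. gain u e) + (\<Sum>e\<in>E. gain y e)"
        by (simp add: gain_x sum.distrib sum_distrib_left)
      have "(\<Sum>e\<in>E. gain u e) < \<theta> * wnorm E u"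
        using less.prems[of A B] AB S
        by (simp add: u_def sum_gain_sign_vec[OF G AB(1)] wnorm_sign_vec[OF AB(1)] S_def)
      then have layer: "t * (\<Sum>e\<in>E. gain u e) < t * (\<theta> * wnorm E u)" using t0 by simp
      have supp: "{i. y $ i \<noteq> 0} \<subset> S"
      proof
        show "{i. y $ i \<noteq> 0} \<subseteq> S" by (auto simp: y S_def)
        have "y $ m = 0" unfolding y m(2) by (simp add: sgn_real_def)
        then show "{i. y $ i \<noteq> 0} \<noteq> S" using m(1) by auto
      qed
      then have "card {i. y $ i \<noteq> 0} < card S" by (intro psubset_card_mono) auto
      then have rest: "(\<Sum>e\<in>E. gain y e) \<le> \<theta> * wnorm E y"
        using less.hyps[of y] less.prems supp by (simp add: S_def subset_trans[OF _ psubset_imp_subset[OF supp, unfolded S_def]])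
      have "(\<Sum>e\<in>E. gain x e) < \<theta> * wnorm E x"
        using layer rest unfolding sum_x norm_x by (simp add: algebra_simps)
      then show ?thesis by simp
    qed
  qed
  then show ?thesis using \<open>x \<noteq> 0\<close> by simp
qed

text \<open>For positive volume this says that \<open>ratio E A B\<close> is at least \<theta>.
  Without the denominator both sides split over a cut that no edge crosses.\<close>

definition tight_pair :: "'v set set \<Rightarrow> real \<Rightarrow> 'v set \<Rightarrow> 'v set \<Rightarrow> bool" where
  "tight_pair E \<theta> A B \<longleftrightarrow> A \<inter> B = {} \<and> A \<union> B \<noteq> {} \<and>
     \<theta> * real (vol E (A \<union> B)) \<le> 2 * real (card (edges_between E A B))"

text \<open>If no edge joins the two parts of a decomposition, one part is tight by the mediant inequality.\<close>
lemma tight_pair_conn: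
  fixes E :: "'v::finite set set"
  assumes "tight_pair E \<theta> A B"
  shows "\<exists>A' B'. tight_pair E \<theta> A' B' \<and> A' \<union> B' \<subseteq> A \<union> B \<and> conn E (A' \<union> B')"
  using assms
proof (induction "card (A \<union> B)" arbitrary: A B rule: less_induct)
  case less
  show ?case
  proof (cases "conn E (A \<union> B)")
    case True
    then show ?thesis using less.prems by auto
  next
    case False
    then obtain P where P: "P \<subset> A \<union> B" "P \<noteq> {}" and
      sep: "\<And>a b. a \<in> P \<Longrightarrow> b \<in> A \<union> B - P \<Longrightarrow> {a, b} \<notin> E"
      unfolding conn_def by meson
    have uni: "(A \<inter> P) \<union> (B \<inter> P) = P" "(A - P) \<union> (B - P) = A \<union> B - P" using P by auto
    have "vol E (A \<union> B) = vol E P + vol E (A \<union> B - P)"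
      unfolding vol_def using sum.subset_diff[of P "A \<union> B" "degree E"] P(1) by (simp add: add.commute psubset_imp_subset)
    moreover have "edges_between E A B \<subseteq> edges_between E (A \<inter> P) (B \<inter> P) \<union> edges_between E (A - P) (B - P)"
    proof
      fix e assume "e \<in> edges_between E A B"
      then obtain a b where ab: "e \<in> E" "a \<in> A" "b \<in> B" "e = {a, b}" by (auto simp: edges_between_def)
      have "a \<in> P \<longleftrightarrow> b \<in> P" using sep[of a b] sep[of b a] ab by (auto simp: insert_commute)
      then show "e \<in> edges_between E (A \<inter> P) (B \<inter> P) \<union> edges_between E (A - P) (B - P)"
        using ab by (cases "a \<in> P") (auto simp: edges_between_def)
    qed
    then have "card (edges_between E A B) \<le> card (edges_between E (A \<inter> P) (B \<inter> P)) + card (edges_between E (A - P) (B - P))"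
      by (intro order_trans[OF card_mono card_Un_le]) auto
    ultimately have "\<theta> * real (vol E P) \<le> 2 * real (card (edges_between E (A \<inter> P) (B \<inter> P))) \<or>
      \<theta> * real (vol E (A \<union> B - P)) \<le> 2 * real (card (edges_between E (A - P) (B - P)))"
      using less.prems unfolding tight_pair_def by (auto simp: algebra_simps)
    then have "tight_pair E \<theta> (A \<inter> P) (B \<inter> P) \<or> tight_pair E \<theta> (A - P) (B - P)"
      using less.prems P unfolding tight_pair_def uni by auto
    moreover have "card P < card (A \<union> B)" "card (A \<union> B - P) < card (A \<union> B)"
      using P by (auto intro!: psubset_card_mono)
    ultimately obtain A' B' where "tight_pair E \<theta> A' B'" "A' \<union> B' \<subseteq> P \<or> A' \<union> B' \<subseteq> A \<union> B - P" "conn E (A' \<union> B')"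
      using less.hyps[of "A \<inter> P" "B \<inter> P"] less.hyps[of "A - P" "B - P"] unfolding uni by metis
    moreover have "A' \<union> B' \<subseteq> A \<union> B" using calculation(2) P(1) by auto
    ultimately show ?thesis by metis
  qed
qed

lemma vol_pos:
  fixes E :: "'v::finite set set"
  assumes "\<forall>i. \<not> isolated E i" "S \<noteq> {}"
  shows "0 < vol E S"
proof -
  obtain i where i: "i \<in> S" using assms(2) by auto
  obtain e where "e \<in> E" "i \<in> e" using assms(1) by (auto simp: isolated_def)
  then have "0 < degree E i" by (auto simp: Defs.degree_def card_gt_0_iff)
  also have "degree E i \<le> vol E S" unfolding vol_def using i by (intro member_le_sum) auto
  finally show ?thesis .
qed

section \<open>The maximum defining \<open>h_plus\<close>, and families built from packings\<close>

definition ratio :: "'v set set \<Rightarrow> 'v set \<Rightarrow> 'v set \<Rightarrow> real" where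
  "ratio E A B = 2 * real (card (edges_between E A B)) / real (vol E (A \<union> B))"

lemma h_plus_ratio:
  "h_plus E k = Max ((\<lambda>V. MIN i\<in>{1..k}. ratio E (V (2 * i - 1)) (V (2 * i))) ` {V. admissible k V})"
  unfolding h_plus_def ratio_def by (simp add: setcompr_eq_image)

text \<open>There are infinitely many functions \<open>V\<close>, but each minimum is attained and
  hence is a value of \<open>ratio\<close> at one of finitely many pairs. Finiteness gives
  \<open>Max\<close> its meaning.\<close>

lemma finite_min_ratios:
  fixes E :: "'v::finite set set"
  assumes "1 \<le> k"
  shows "finite ((\<lambda>V. MIN i\<in>{1..k}. ratio E (V (2 * i - 1)) (V (2 * i))) ` {V. admissible k V})"
proof (rule finite_subset)
  show "finite (range (\<lambda>(A, B). ratio E A B))" by simp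
  show "(\<lambda>V. MIN i\<in>{1..k}. ratio E (V (2 * i - 1)) (V (2 * i))) ` {V. admissible k V} \<subseteq> range (\<lambda>(A, B). ratio E A B)"
  proof (rule image_subsetI)
    fix V :: "nat \<Rightarrow> 'v set"
    have "(MIN i\<in>{1..k}. ratio E (V (2 * i - 1)) (V (2 * i))) \<in> (\<lambda>i. ratio E (V (2 * i - 1)) (V (2 * i))) ` {1..k}"
      using assms by (intro Min_in) auto
    then obtain i where "(MIN i\<in>{1..k}. ratio E (V (2 * i - 1)) (V (2 * i))) = ratio E (V (2 * i - 1)) (V (2 * i))"
      by (elim imageE) (rule that)
    then show "(MIN i\<in>{1..k}. ratio E (V (2 * i - 1)) (V (2 * i))) \<in> range (\<lambda>(A, B). ratio E A B)"
      by (auto intro: rev_image_eqI[of "(V (2 * i - 1), V (2 * i))"])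
  qed
qed

lemma h_plus_ge:
  fixes E :: "'v::finite set set"
  assumes "1 \<le> k" "admissible k V" "\<And>i. i \<in> {1..k} \<Longrightarrow> \<theta> \<le> ratio E (V (2 * i - 1)) (V (2 * i))"
  shows "\<theta> \<le> h_plus E k"
proof -
  have "\<theta> \<le> (MIN i\<in>{1..k}. ratio E (V (2 * i - 1)) (V (2 * i)))"
    using assms(1,3) by (subst Min_ge_iff) auto
  also have "\<dots> \<le> h_plus E k"
    unfolding h_plus_ratio using assms(2) by (intro Max_ge finite_min_ratios assms(1)) auto
  finally show ?thesis .
qed

text \<open>Ensures that the maximum in \<open>h_plus\<close> is over a nonempty set: the odd
  positions receive distinct single vertices, the even ones the empty set.\<close>

lemma admissible_exists:
  assumes "k \<le> CARD('v::finite)"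
  shows "\<exists>V :: nat \<Rightarrow> 'v set. admissible k V"
proof -
  obtain b where b: "bij_betw b {0..<CARD('v)} (UNIV :: 'v set)"
    using ex_bij_betw_nat_finite[of "UNIV :: 'v set"] by auto
  define V where "V n = (if odd n then {b (n div 2)} else {})" for n
  have "admissible k V"
    unfolding admissible_def
  proof (intro conjI ballI)
    show "disjoint_family_on V {1..2 * k}"
      unfolding disjoint_family_on_def
    proof (intro ballI impI)
      fix m n assume mn: "m \<in> {1..2 * k}" "n \<in> {1..2 * k}" "m \<noteq> n"
      show "V m \<inter> V n = {}"
      proof (cases "odd m \<and> odd n")
        case True
        then have "m div 2 \<noteq> n div 2" using mn by (metis odd_two_times_div_two_succ)
        moreover have "m div 2 < CARD('v)" "n div 2 < CARD('v)" using mn assms True by (auto elim!: oddE)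
        ultimately have "b (m div 2) \<noteq> b (n div 2)"
          using inj_onD[OF bij_betw_imp_inj_on[OF b], of "m div 2" "n div 2"] by auto
        then show ?thesis by (simp add: V_def)
      qed (auto simp: V_def)
    qed
    fix i assume "i \<in> {1..k}"
    then show "V (2 * i - 1) \<union> V (2 * i) \<noteq> {}" by (auto simp: V_def)
  qed
  then show ?thesis by blast
qed

lemma h_plus_attained:
  fixes E :: "'v::finite set set"
  assumes "1 \<le> k" "k \<le> CARD('v)"
  obtains V where "admissible k V" "\<And>i. i \<in> {1..k} \<Longrightarrow> h_plus E k \<le> ratio E (V (2 * i - 1)) (V (2 * i))"
proof -
  have "h_plus E k \<in> (\<lambda>V. MIN i\<in>{1..k}. ratio E (V (2 * i - 1)) (V (2 * i))) ` {V. admissible k V}"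
    unfolding h_plus_ratio using admissible_exists[OF assms(2)]
    by (intro Max_in finite_min_ratios assms(1)) auto
  then obtain V where V: "admissible k V" "h_plus E k = (MIN i\<in>{1..k}. ratio E (V (2 * i - 1)) (V (2 * i)))"
    by auto
  show ?thesis by (rule that[OF V(1)]) (simp add: V(2))
qed

text \<open>The tight pairs of \<open>k\<close> disjoint members, listed one after the other, form
  an admissible family; as volumes are positive, tightness becomes a lower bound on each
  \<open>ratio\<close>.\<close>

lemma packing_le_h_plus:
  fixes E :: "'v::finite set set"
  assumes iso: "\<forall>i. \<not> isolated E i" and k: "1 \<le> k" "k \<le> card M" and "finite M"
    and M: "disjoint M" "\<And>C. C \<in> M \<Longrightarrow> \<exists>A B. tight_pair E \<theta> A B \<and> A \<union> B = C"
  shows "\<theta> \<le> h_plus E k"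
proof -
  obtain c where c: "bij_betw c {0..<card M} M" using ex_bij_betw_nat_finite[OF \<open>finite M\<close>] by auto
  have cM: "c i \<in> M" if "i < k" for i using bij_betwE[OF c] that k by auto
  have "\<forall>C\<in>M. \<exists>p. tight_pair E \<theta> (fst p) (snd p) \<and> fst p \<union> snd p = C" using M(2) by fastforce
  from bchoice[OF this] obtain p where p: "\<And>C. C \<in> M \<Longrightarrow> tight_pair E \<theta> (fst (p C)) (snd (p C))"
    "\<And>C. C \<in> M \<Longrightarrow> fst (p C) \<union> snd (p C) = C" by auto
  \<comment> \<open>Positions \<open>2 * i - 1\<close> and \<open>2 * i\<close> hold the two halves
    of the pair of member number \<open>i - 1\<close>; \<open>q\<close> below computes this number
    from a position.\<close>
  define V where "V n = (if odd n then fst (p (c (n div 2))) else snd (p (c (n div 2 - 1))))" for n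
  define q where "q n = (if odd n then n div 2 else n div 2 - 1)" for n :: nat
  have q: "q n < k" "V n \<subseteq> c (q n)" if "n \<in> {1..2 * k}" for n
  proof -
    show *: "q n < k" using that by (auto simp: q_def elim!: oddE evenE)
    show "V n \<subseteq> c (q n)" using p(2)[OF cM[OF *]] by (auto simp: q_def V_def)
  qed
  have V: "V (2 * i - 1) = fst (p (c (i - 1)))" "V (2 * i) = snd (p (c (i - 1)))" if "i \<in> {1..k}" for i
  proof -
    have "odd (2 * i - 1)" "(2 * i - 1) div 2 = i - 1" using that by auto
    then show "V (2 * i - 1) = fst (p (c (i - 1)))" by (simp add: V_def)
    show "V (2 * i) = snd (p (c (i - 1)))" by (simp add: V_def)
  qed
  have T: "tight_pair E \<theta> (V (2 * i - 1)) (V (2 * i))" if "i \<in> {1..k}" for i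
    unfolding V[OF that] using that by (intro p(1) cM) auto
  show ?thesis
  proof (rule h_plus_ge[OF k(1)])
    show "admissible k V"
      unfolding admissible_def
    proof (intro conjI ballI)
      show "V (2 * i - 1) \<union> V (2 * i) \<noteq> {}" if "i \<in> {1..k}" for i
        using T[OF that] by (simp add: tight_pair_def)
      show "disjoint_family_on V {1..2 * k}"
        unfolding disjoint_family_on_def
      proof (intro ballI impI)
        fix m n assume mn: "m \<in> {1..2 * k}" "n \<in> {1..2 * k}" "m \<noteq> n"
        show "V m \<inter> V n = {}"
        proof (cases "q m = q n")
          case True
          \<comment> \<open>Distinct positions with the same member have different parity, so they
            are the two disjoint halves of one tight pair.\<close>
          have neq: "odd m \<noteq> odd n"
          proof
            assume "odd m = odd n"
            with True have "m = n" using mn by (auto simp: q_def elim!: oddE evenE)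
            then show False using mn by simp
          qed
          have "fst (p (c (q m))) \<inter> snd (p (c (q m))) = {}"
            using p(1)[OF cM[OF q(1)[OF mn(1)]]] by (simp add: tight_pair_def)
          then show ?thesis using neq True by (cases "odd m") (auto simp: V_def q_def)
        next
          case False
          have "c (q m) \<noteq> c (q n)"
            using inj_onD[OF bij_betw_imp_inj_on[OF c], of "q m" "q n"] False q(1)[OF mn(1)] q(1)[OF mn(2)] k by auto
          then have "c (q m) \<inter> c (q n) = {}"
            using M(1) cM[OF q(1)[OF mn(1)]] cM[OF q(1)[OF mn(2)]] by (auto simp: pairwise_def disjnt_def)
          then show ?thesis using q(2)[OF mn(1)] q(2)[OF mn(2)] by auto
        qed
      qed
    qed
    fix i assume i: "i \<in> {1..k}"
    then have "0 < vol E (V (2 * i - 1) \<union> V (2 * i))"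
      using T[OF i] by (intro vol_pos[OF iso]) (simp add: tight_pair_def)
    then show "\<theta> \<le> ratio E (V (2 * i - 1)) (V (2 * i))"
      using T[OF i] by (simp add: ratio_def tight_pair_def pos_le_divide_eq)
  qed
qed

lemma small_hitting_set:
  fixes E :: "'v::finite set set"
  assumes "forest E" "\<forall>i. \<not> isolated E i" "1 \<le> k" and h: "h_plus E k < \<theta>"
  obtains H where "card H < k" "\<And>x. x \<in> X E \<Longrightarrow> I_plus E x \<le> 1 - \<theta> \<Longrightarrow> \<exists>i\<in>H. x $ i \<noteq> 0"
proof -
  define F where "F = {C. conn E C \<and> (\<exists>A B. tight_pair E \<theta> A B \<and> A \<union> B = C)}"
  have "\<forall>C\<in>F. C \<subseteq> UNIV \<and> C \<noteq> {} \<and> conn E C" by (auto simp: F_def tight_pair_def)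
  from forest_packing_covering[OF assms(1) finite this]
  obtain H M where HM: "M \<subseteq> F" "disjoint M" "finite M" "card H = card M" "\<forall>C\<in>F. C \<inter> H \<noteq> {}"
    by (elim exE conjE) (rule that)
  have "card M < k"
  proof (rule ccontr)
    assume "\<not> card M < k"
    then have "\<theta> \<le> h_plus E k"
      using HM(1) by (intro packing_le_h_plus[OF assms(2,3) _ HM(3,2)]) (auto simp: F_def)
    then show False using h by simp
  qed
  moreover have "\<exists>i\<in>H. x $ i \<noteq> 0" if x: "x \<in> X E" "I_plus E x \<le> 1 - \<theta>" for x
  proof -
    have G: "simple_graph E" using assms(1) by (simp add: forest_def)
    have N: "wnorm E x = 1" using x(1) by (simp add: X_def wnorm_def)
    then have "x \<noteq> 0" by (auto simp: wnorm_def)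
    \<comment> \<open>On \<open>X E\<close> the bound on \<open>I_plus\<close> says that the total
      gain is at least \<theta>. This contradicts the conclusion of \<open>layer_cake\<close>, so
      some pair inside the support of \<open>x\<close> must be tight.\<close>
    have "\<not> (\<Sum>e\<in>E. gain x e) < \<theta> * wnorm E x"
      using x(2) wnorm_minus_I_plus[of E x] N by simp
    then have "\<not> (\<forall>A B. A \<inter> B = {} \<longrightarrow> A \<union> B \<noteq> {} \<longrightarrow> A \<union> B \<subseteq> {i. x $ i \<noteq> 0} \<longrightarrow>
        2 * real (card (edges_between E A B)) < \<theta> * real (vol E (A \<union> B)))"
      using layer_cake[OF G _ \<open>x \<noteq> 0\<close>, of \<theta>] by metis
    then obtain A B where "tight_pair E \<theta> A B" and AB: "A \<union> B \<subseteq> {i. x $ i \<noteq> 0}"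
      unfolding tight_pair_def by (meson not_less)
    from tight_pair_conn[OF this(1)] obtain A' B' where
      "tight_pair E \<theta> A' B'" "A' \<union> B' \<subseteq> A \<union> B" "conn E (A' \<union> B')" by (elim exE conjE) (rule that)
    then have "(A' \<union> B') \<inter> H \<noteq> {}" using HM(5) unfolding F_def by auto
    then obtain i where "i \<in> A' \<union> B'" "i \<in> H" by auto
    moreover have "A' \<union> B' \<subseteq> {i. x $ i \<noteq> 0}" using AB \<open>A' \<union> B' \<subseteq> A \<union> B\<close> by (rule subset_trans[rotated])
    ultimately have "x $ i \<noteq> 0" by blast
    then show ?thesis using \<open>i \<in> H\<close> by (rule bexI)
  qed
  ultimately show ?thesis using that HM(4) by metis
qed

section \<open>The Borsuk-Ulam theorem\<close>

text \<open>The carrier of \<open>nsphere n\<close>: the unit sphere in the first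
  \<open>n + 1\<close> coordinates. All dimensions share one sequence space, so
  \<open>usphere (n - 1)\<close> is literally the equator of \<open>usphere n\<close> for positive
  \<open>n\<close>.\<close>

definition usphere :: "nat \<Rightarrow> (nat \<Rightarrow> real) set" where
  "usphere n = {x. (\<Sum>i\<le>n. (x i)\<^sup>2) = 1 \<and> (\<forall>i>n. x i = 0)}"

lemma nsphere_eq_top_of_set: "nsphere n = top_of_set (usphere n)"
  by (simp add: nsphere usphere_def euclidean_product_topology)

lemma topspace_nsphere: "topspace (nsphere n) = usphere n"
  by (simp add: nsphere_eq_top_of_set)

lemma continuous_map_nsphere_iff:
  "continuous_map (nsphere n) (nsphere m) f \<longleftrightarrow> continuous_on (usphere n) f \<and> f \<in> usphere n \<rightarrow> usphere m"
  by (simp add: nsphere_eq_top_of_set image_subset_iff_funcset)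

lemma usphere_mono: "m \<le> n \<Longrightarrow> usphere m \<subseteq> usphere n"
proof
  fix x assume "m \<le> n" "x \<in> usphere m"
  moreover from this have "(\<Sum>i\<le>n. (x i)\<^sup>2) = (\<Sum>i\<le>m. (x i)\<^sup>2)"
    by (intro sum.mono_neutral_right) (auto simp: usphere_def)
  ultimately show "x \<in> usphere n" by (auto simp: usphere_def)
qed

lemma uminus_usphere: "x \<in> usphere n \<Longrightarrow> (\<lambda>i. - x i) \<in> usphere n"
  by (simp add: usphere_def)

text \<open>Projection to the sphere along rays. Where the first \<open>n + 1\<close> coordinates
  vanish, division by zero yields 0, which is off the sphere; hence the nonvanishing assumptions
  below.\<close>

definition radial :: "nat \<Rightarrow> (nat \<Rightarrow> real) \<Rightarrow> nat \<Rightarrow> real" where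
  "radial n y = (\<lambda>i. y i / sqrt (\<Sum>j\<le>n. (y j)\<^sup>2))"

lemma radial_in_usphere:
  assumes "\<exists>i\<le>n. y i \<noteq> 0" "\<And>i. i > n \<Longrightarrow> y i = 0"
  shows "radial n y \<in> usphere n"
proof -
  have "(\<Sum>j\<le>n. (y j)\<^sup>2) \<noteq> 0" using assms(1) by (auto simp: sum_nonneg_eq_0_iff)
  moreover have "0 \<le> (\<Sum>j\<le>n. (y j)\<^sup>2)" by (simp add: sum_nonneg)
  ultimately show ?thesis using assms(2)
    by (simp add: usphere_def radial_def power_divide flip: sum_divide_distrib)
qed

lemma radial_usphere: "y \<in> usphere n \<Longrightarrow> radial n y = y"
  by (simp add: usphere_def radial_def)

lemma radial_uminus: "radial n (\<lambda>i. - y i) = (\<lambda>i. - radial n y i)"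
  by (simp add: radial_def)

lemma continuous_on_radial:
  assumes f: "continuous_on S f" and nz: "\<And>x. x \<in> S \<Longrightarrow> \<exists>i\<le>n. f x i \<noteq> 0"
  shows "continuous_on S (\<lambda>x. radial n (f x))"
proof -
  have "sqrt (\<Sum>j\<le>n. (f x j)\<^sup>2) \<noteq> 0" if "x \<in> S" for x
    using nz[OF that] by (auto simp: sum_nonneg_eq_0_iff)
  then show ?thesis
    unfolding radial_def
    by (intro continuous_on_coordinatewise_then_product continuous_intros
        continuous_on_product_then_coordinatewise[OF f]) auto
qed

text \<open>Projects the straight-line homotopy; the last assumption says that no segment from
  \<open>f x\<close> to \<open>g x\<close> meets the origin.\<close>

lemma homotopic_radial:
  assumes f: "continuous_on (usphere m) f" "\<And>x i. x \<in> usphere m \<Longrightarrow> i > n \<Longrightarrow> f x i = 0"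
    and g: "continuous_on (usphere m) g" "\<And>x i. x \<in> usphere m \<Longrightarrow> i > n \<Longrightarrow> g x i = 0"
    and nz: "\<And>x t. x \<in> usphere m \<Longrightarrow> 0 \<le> t \<Longrightarrow> t \<le> 1 \<Longrightarrow> \<exists>i\<le>n. (1 - t) * f x i + t * g x i \<noteq> 0"
  shows "homotopic_with (\<lambda>_. True) (nsphere m) (nsphere n) (\<lambda>x. radial n (f x)) (\<lambda>x. radial n (g x))"
proof -
  let ?h = "\<lambda>z :: real \<times> (nat \<Rightarrow> real). \<lambda>i. (1 - fst z) * f (snd z) i + fst z * g (snd z) i"
  have "continuous_on ({0..1 :: real} \<times> usphere m) (\<lambda>z. f (snd z))" "continuous_on ({0..1 :: real} \<times> usphere m) (\<lambda>z. g (snd z))"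
    by (rule continuous_on_compose2[OF f(1)] continuous_on_compose2[OF g(1)]; force intro: continuous_on_snd)+
  note fg = this[THEN continuous_on_product_then_coordinatewise]
  have h: "continuous_on ({0..1} \<times> usphere m) ?h"
    by (intro continuous_on_coordinatewise_then_product continuous_on_add continuous_on_mult
        continuous_on_diff continuous_on_const continuous_on_fst continuous_on_id fg)
  have "continuous_on ({0..1} \<times> usphere m) (\<lambda>z. radial n (?h z))"
    by (rule continuous_on_radial[OF h]) (use nz in auto)
  moreover have "radial n (?h z) \<in> usphere n" if "z \<in> {0..1} \<times> usphere m" for z
    using that nz[of "snd z" "fst z"] f(2) g(2) by (intro radial_in_usphere) auto
  ultimately show ?thesis
    unfolding nsphere_eq_top_of_set homotopic_with_def
    by (intro exI[of _ "\<lambda>z. radial n (?h z)"])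
      (auto simp: prod_topology_subtopology_eu continuous_map_subtopology_eu)
qed

text \<open>Here and below \<open>'v\<close> only supplies a Euclidean space \<open>real ^ 'v\<close> large enough to contain the sphere.\<close>
lemma odd_smooth_approximation:
  fixes f :: "(nat \<Rightarrow> real) \<Rightarrow> nat \<Rightarrow> real"
  assumes "0 < n" "n < CARD('v::finite)"
    and f: "continuous_on (usphere n) f" "f \<in> usphere n \<rightarrow> usphere n"
      "\<And>x. x \<in> usphere n \<Longrightarrow> f (\<lambda>i. - x i) = (\<lambda>i. - f x i)"
  obtains g p where "continuous_on (usphere n) g"
    "\<And>x. x \<in> usphere n \<Longrightarrow> g (\<lambda>i. - x i) = (\<lambda>i. - g x i)"
    "\<And>x i. x \<in> usphere n \<Longrightarrow> i > n \<Longrightarrow> g x i = 0"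
    "\<And>x. x \<in> usphere n \<Longrightarrow> (\<Sum>i\<le>n. (f x i - g x i)\<^sup>2) < 1"
    "p \<in> usphere n" "\<And>x c. x \<in> usphere (n - 1) \<Longrightarrow> g x \<noteq> (\<lambda>i. c * p i)"
proof -
  define N where "N = CARD('v)"
  obtain b where b: "bij_betw b {0..<N} (UNIV :: 'v set)"
    using ex_bij_betw_nat_finite[of "UNIV :: 'v set"] by (auto simp: N_def)
  define c where "c = inv_into {0..<N} b"
  have cb: "c (b i) = i" if "i < N" for i
    unfolding c_def using b that by (intro inv_into_f_f) (auto simp: bij_betw_def)
  have bc: "b (c v) = v" and cN: "c v < N" for v
    using f_inv_into_f[of v b "{0..<N}"] inv_into_into[of v b "{0..<N}"] b
    by (auto simp: bij_betw_def c_def)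
  \<comment> \<open>\<open>T m\<close> is a copy of Euclidean \<open>(m + 1)\<close>-space for
    \<open>m < N\<close>. \<open>D\<close> and \<open>L\<close> pass between it and sequences,
    respecting norms, so that polynomial approximation and differentiability become
    available.\<close>
  define T where "T m = {y :: real ^ 'v. \<forall>v. m < c v \<longrightarrow> y $ v = 0}" for m
  define D :: "real ^ 'v \<Rightarrow> nat \<Rightarrow> real" where "D y = (\<lambda>i. if i < N then y $ b i else 0)" for y
  define L :: "(nat \<Rightarrow> real) \<Rightarrow> real ^ 'v" where "L x = (\<chi> v. x (c v))" for x
  have nN: "n < N" using assms(2) by (simp add: N_def)
  have subT: "subspace (T m)" for m by (auto simp: T_def subspace_def)
  have LD: "L (D y) = y" for y by (simp add: L_def D_def vec_eq_iff cN bc)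
  have DL: "D (L x) = x" if "\<And>i. i > n \<Longrightarrow> x i = 0" for x
    using that nN by (auto simp: L_def D_def fun_eq_iff cb)
  have Dz: "D y i = 0" if "y \<in> T m" "i > m" for y i m
    using that cb[of i] by (auto simp: T_def D_def)
  have Dsum: "(\<Sum>i\<le>m. (D y i)\<^sup>2) = (norm y)\<^sup>2" if "y \<in> T m" "m < N" for y m
  proof -
    have "(norm y)\<^sup>2 = (\<Sum>v\<in>UNIV. (y $ v)\<^sup>2)"
      by (simp add: norm_vec_def L2_set_def sum_nonneg)
    also have "\<dots> = (\<Sum>i\<in>{0..<N}. (y $ b i)\<^sup>2)"
      by (rule sum.reindex_bij_betw[OF b, symmetric])
    also have "\<dots> = (\<Sum>i\<in>{0..<N}. (D y i)\<^sup>2)" by (simp add: D_def)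
    also have "\<dots> = (\<Sum>i\<le>m. (D y i)\<^sup>2)"
      using that Dz[OF that(1)] by (intro sum.mono_neutral_right) auto
    finally show ?thesis by simp
  qed
  have D_in: "D y \<in> usphere m" if "y \<in> sphere 0 1 \<inter> T m" "m < N" for y m
    using that Dsum[of y m] Dz[of y m] by (auto simp: usphere_def)
  have L_T: "L x \<in> T m" if "\<And>i. i > m \<Longrightarrow> x i = 0" for x m
    using that by (simp add: L_def T_def)
  have L_in: "L x \<in> sphere 0 1 \<inter> T m" if x: "x \<in> usphere m" and "m \<le> n" for x m
  proof -
    have *: "L x \<in> T m" using x by (intro L_T) (simp add: usphere_def)
    have "D (L x) = x" using x \<open>m \<le> n\<close> by (intro DL) (simp add: usphere_def)
    then have "(norm (L x))\<^sup>2 = 1" using Dsum[OF *] x nN \<open>m \<le> n\<close> by (simp add: usphere_def)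
    then show ?thesis using * by (simp add: power2_eq_1_iff order.order_iff_strict[of 0] flip: norm_eq_zero) (use norm_ge_zero[of "L x"] in linarith)
  qed
  have L_neg: "L (\<lambda>i. - x i) = - L x" for x by (simp add: L_def vec_eq_iff)
  have D_neg: "D (- y) = (\<lambda>i. - D y i)" for y by (auto simp: D_def)
  have contD: "continuous_on S D" for S
    unfolding D_def
  proof (rule continuous_on_coordinatewise_then_product)
    fix i show "continuous_on S (\<lambda>y. if i < N then y $ b i else 0)"
      by (cases "i < N") (simp_all add: continuous_on_component continuous_on_id)
  qed
  have contL: "continuous_on S L" for S
    unfolding L_def
    by (intro continuous_on_vec_lambda continuous_on_subset[OF continuous_on_product_coordinates]) auto
  let ?S = "sphere 0 1 \<inter> T n"
  let ?F = "L \<circ> f \<circ> D"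
  have "continuous_on ?S (\<lambda>y. f (D y))"
    by (rule continuous_on_compose2[OF f(1) contD]) (use D_in nN in auto)
  then have contF: "continuous_on ?S ?F"
    unfolding o_def by (rule continuous_on_compose2[OF contL[of UNIV]]) auto
  have F_in: "?F y \<in> ?S" if "y \<in> ?S" for y
    using L_in[of "f (D y)" n] D_in[OF that nN] f(2) by auto
  have F_neg: "?F (- y) = - ?F y" if "y \<in> ?S" for y
    using D_in[OF that nN] by (simp add: D_neg f(3) L_neg)
  have cpt: "compact ?S" by (simp add: subT closed_subspace compact_Int_closed)
  have FT: "?F ` ?S \<subseteq> T n" using F_in by (intro image_subsetI) (rule IntD2)
  obtain G where G: "polynomial_function G" "G ` ?S \<subseteq> T n" "\<And>y. y \<in> ?S \<Longrightarrow> norm (?F y - G y) < 1"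
    by (rule Stone_Weierstrass_polynomial_function_subspace[OF cpt contF zero_less_one subT FT]) (rule that)
  \<comment> \<open>The odd part of the polynomial map. Since \<open>?F\<close> is odd, its error is
    the average of two errors of \<open>G\<close>, hence still below 1.\<close>
  define G1 where "G1 y = (1/2) *\<^sub>R (G y - G (- y))" for y
  have neg_S: "- y \<in> ?S" if "y \<in> ?S" for y using that subspace_neg[OF subT] by auto
  have G1_neg: "G1 (- y) = - G1 y" for y by (simp add: G1_def algebra_simps)
  have "polynomial_function (\<lambda>y. G (- y))"
    using polynomial_function_compose[of uminus G] G(1) polynomial_function_minus[OF polynomial_function_id]
    by (simp add: o_def)
  then have diffG1: "G1 differentiable_on S" for S
    unfolding G1_def using G(1)
    by (intro differentiable_on_polynomial_function polynomial_function_cmul polynomial_function_diff) auto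
  have G1_T: "G1 y \<in> T n" if "y \<in> ?S" for y
    unfolding G1_def using that neg_S G(2)
    by (intro subspace_mul[OF subT] subspace_diff[OF subT]) auto
  have close: "norm (?F y - G1 y) < 1" if y: "y \<in> ?S" for y
  proof -
    have "?F y - G1 y = (1/2) *\<^sub>R ((?F y - G y) - (?F (- y) - G (- y)))"
      unfolding F_neg[OF y] G1_def by (simp add: algebra_simps flip: scaleR_add_left)
    then have "norm (?F y - G1 y) \<le> (1/2) * (norm (?F y - G y) + norm (?F (- y) - G (- y)))"
      using norm_triangle_ineq4[of "?F y - G y" "?F (- y) - G (- y)"] by simp
    also have "\<dots> < (1/2) * (1 + 1)"
      by (intro mult_strict_left_mono add_strict_mono G(3) y neg_S) simp
    finally show ?thesis by simp
  qed
  have G1_nz: "G1 y \<noteq> 0" if "y \<in> ?S" for y using close[OF that] F_in[OF that] by auto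
  \<comment> \<open>The normalised map is differentiable on the equator, and a differentiable map
    into a sphere of larger dimension is not onto. The omitted value \<open>d\<close> supplies
    \<open>p\<close>.\<close>
  define h where "h y = inverse (norm (G1 y)) *\<^sub>R G1 y" for y
  have h_neg: "h (- y) = - h y" for y by (simp add: h_def G1_neg)
  have T_mono: "T (n - 1) \<subseteq> T n" by (auto simp: T_def)
  have "axis (b n) 1 \<in> T n - T (n - 1)"
    using nN cb[OF nN] assms(1) by (auto simp: T_def axis_def)
  then have "span (T (n - 1)) \<subset> span (T n)"
    using T_mono unfolding span_eq_iff[THEN iffD2, OF subT] by auto
  then have dim: "dim (T (n - 1)) < dim (T n)" by (rule dim_psubset)
  have "h differentiable_on sphere 0 1 \<inter> T (n - 1)"
    unfolding h_def using G1_nz T_mono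
    by (intro derivative_intros diffG1 differentiable_on_compose[OF diffG1]) auto
  from spheremap_lemma1[OF subT subT dim T_mono this]
  obtain d where d: "d \<in> ?S" "d \<notin> h ` (sphere 0 1 \<inter> T (n - 1))"
  proof -
    have "h ` (sphere 0 1 \<inter> T (n - 1)) \<subseteq> ?S"
    proof (rule image_subsetI)
      fix y assume "y \<in> sphere 0 1 \<inter> T (n - 1)"
      then have "y \<in> ?S" using T_mono by auto
      then show "h y \<in> ?S"
        using G1_nz[of y] G1_T[of y] subspace_mul[OF subT] by (auto simp: h_def)
    qed
    then show ?thesis using that \<open>h ` (sphere 0 1 \<inter> T (n - 1)) \<noteq> ?S\<close> by blast
  qed
  define g where "g x = D (G1 (L x))" for x
  show ?thesis
  proof (rule that[of g "D d"])
    have "continuous_on (usphere n) (\<lambda>x. G1 (L x))"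
      by (rule continuous_on_compose2[OF differentiable_imp_continuous_on[OF diffG1[of UNIV]] contL]) auto
    then show "continuous_on (usphere n) g"
      unfolding g_def by (rule continuous_on_compose2[OF contD[of UNIV]]) auto
    show "D d \<in> usphere n" by (rule D_in[OF d(1) nN])
    fix x
    {
      assume x: "x \<in> usphere n"
      show "g (\<lambda>i. - x i) = (\<lambda>i. - g x i)" by (simp add: g_def L_neg G1_neg D_neg)
      show "g x i = 0" if "i > n" for i
        unfolding g_def using G1_T[OF L_in[OF x]] that by (intro Dz) auto
      have DLx: "D (L x) = x" using x by (intro DL) (simp add: usphere_def)
      have "f x \<in> usphere n" using x f(2) by auto
      then have "f x = D (?F (L x))" using DLx DL[of "f x"] by (simp add: usphere_def)
      then have "f x i - g x i = D (?F (L x) - G1 (L x)) i" for i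
        by (simp add: g_def D_def)
      moreover have "?F (L x) - G1 (L x) \<in> T n"
        using F_in[OF L_in[OF x]] G1_T[OF L_in[OF x]] by (intro subspace_diff[OF subT]) auto
      ultimately have "(\<Sum>i\<le>n. (f x i - g x i)\<^sup>2) = (norm (?F (L x) - G1 (L x)))\<^sup>2"
        using Dsum nN by simp
      also have "\<dots> < 1" using close[OF L_in[OF x]] by (simp add: power_less_one_iff)
      finally show "(\<Sum>i\<le>n. (f x i - g x i)\<^sup>2) < 1" .
    }
    fix r assume x: "x \<in> usphere (n - 1)"
    show "g x \<noteq> (\<lambda>i. r * D d i)"
    proof
      assume eq: "g x = (\<lambda>i. r * D d i)"
      have Lx: "L x \<in> sphere 0 1 \<inter> T (n - 1)" by (rule L_in[OF x]) simp
      then have Lx': "L x \<in> ?S" using T_mono by auto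
      have "D (G1 (L x)) = D (r *\<^sub>R d)" using eq by (auto simp: g_def D_def fun_eq_iff)
      then have G1r: "G1 (L x) = r *\<^sub>R d" using LD by metis
      then have "r \<noteq> 0" "norm (G1 (L x)) = \<bar>r\<bar>" using G1_nz[OF Lx'] d(1) by auto
      then have "h (L x) = (r / \<bar>r\<bar>) *\<^sub>R d" by (simp add: h_def G1r field_simps)
      \<comment> \<open>If \<open>g x\<close> lies on the line through \<open>D d\<close>, then
        \<open>h\<close> takes the value \<open>d\<close> or \<open>- d\<close> at
        \<open>L x\<close>; oddness turns the second case into the value \<open>d\<close> at
        \<open>- L x\<close>.\<close>
      then have "h (L x) = d \<or> h (- L x) = d" using \<open>r \<noteq> 0\<close> by (cases "r > 0") (auto simp: h_neg)
      moreover have "- L x \<in> sphere 0 1 \<inter> T (n - 1)" using Lx subspace_neg[OF subT] by auto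
      ultimately show False using d(2) Lx by (metis imageI)
    qed
  qed
qed

lemma usphere_dot_eq_0:
  fixes x p :: "nat \<Rightarrow> real"
  assumes "\<And>i. i > m \<Longrightarrow> x i = 0" "p \<in> usphere m" "x = (\<lambda>i. c * p i)"
  shows "(\<Sum>i\<le>m. x i * p i) = c"
proof -
  have "(\<Sum>i\<le>m. x i * p i) = c * (\<Sum>i\<le>m. (p i)\<^sup>2)"
    unfolding assms(3) sum_distrib_left by (simp add: power2_eq_square mult_ac)
  then show ?thesis using assms(2) by (simp add: usphere_def)
qed

text \<open>The Householder reflection exchanging \<open>p\<close> with the last unit vector.\<close>
lemma reflection_to_equator:
  assumes p: "p \<in> usphere m"
  obtains R where "continuous_on UNIV R" "R \<in> usphere m \<rightarrow> usphere m"
    "\<And>y. R (\<lambda>i. - y i) = (\<lambda>i. - R y i)"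
    "\<And>y. (\<Sum>i\<le>m. y i * p i) = 0 \<Longrightarrow> R y m = 0"
proof (cases "p m = 1")
  case True
  have "(\<Sum>i\<le>m. (p i)\<^sup>2) = (\<Sum>i<m. (p i)\<^sup>2) + (p m)\<^sup>2"
    by (simp add: lessThan_Suc_atMost[symmetric])
  then have "(\<Sum>i<m. (p i)\<^sup>2) = 0" using p True by (simp add: usphere_def)
  then have 0: "p i = 0" if "i < m" for i using that by (simp add: sum_nonneg_eq_0_iff)
  show ?thesis
  proof (rule that[of id])
    fix y assume "(\<Sum>i\<le>m. y i * p i) = 0"
    moreover have "(\<Sum>i\<le>m. y i * p i) = (\<Sum>i<m. y i * p i) + y m * p m"
      by (simp add: lessThan_Suc_atMost[symmetric])
    ultimately show "id y m = 0" using 0 True by simp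
  qed auto
next
  case False
  \<comment> \<open>The reflection is in the hyperplane orthogonal to \<open>p\<close> minus the
    last unit vector. This difference vanishes in the first case, where the identity already
    works.\<close>
  define w where "w i = p i - (if i = m then 1 else 0)" for i
  define W where "W = (\<Sum>i\<le>m. (w i)\<^sup>2)"
  define s where "s y = 2 * (\<Sum>i\<le>m. y i * w i) / W" for y
  define R where "R y = (\<lambda>i. y i - s y * w i)" for y
  have dot_w: "(\<Sum>i\<le>m. y i * w i) = (\<Sum>i\<le>m. y i * p i) - y m" for y :: "nat \<Rightarrow> real"
    by (simp add: w_def right_diff_distrib sum_subtractf if_distrib[of "(*) _"] cong: if_cong)
  have "W = (\<Sum>i\<le>m. w i * w i)" by (simp add: W_def power2_eq_square)
  also have "\<dots> = (\<Sum>i\<le>m. w i * p i) - w m" by (rule dot_w)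
  also have "(\<Sum>i\<le>m. w i * p i) = (\<Sum>i\<le>m. p i * w i)" by (simp add: mult.commute)
  also have "\<dots> = (\<Sum>i\<le>m. p i * p i) - p m" by (rule dot_w)
  also have "(\<Sum>i\<le>m. p i * p i) = 1" using p by (simp add: usphere_def power2_eq_square)
  finally have W: "W = 2 * (1 - p m)" by (simp add: w_def)
  then have W0: "W \<noteq> 0" using False by simp
  have wz: "w i = 0" if "i > m" for i using p that by (simp add: w_def usphere_def)
  show ?thesis
  proof (rule that[of R])
    show "continuous_on UNIV R"
      unfolding R_def s_def
      by (intro continuous_on_coordinatewise_then_product continuous_intros continuous_on_product_coordinates) (use W0 in auto)
    show "R (\<lambda>i. - y i) = (\<lambda>i. - R y i)" for y
      by (simp add: R_def s_def sum_negf)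
    show "R \<in> usphere m \<rightarrow> usphere m"
    proof
      fix y assume y: "y \<in> usphere m"
      have "(\<Sum>i\<le>m. (R y i)\<^sup>2) = (\<Sum>i\<le>m. (y i)\<^sup>2 - 2 * s y * (y i * w i) + (s y)\<^sup>2 * (w i)\<^sup>2)"
        by (simp add: R_def power2_eq_square algebra_simps)
      also have "\<dots> = (\<Sum>i\<le>m. (y i)\<^sup>2) - 2 * s y * (\<Sum>i\<le>m. y i * w i) + (s y)\<^sup>2 * W"
        by (simp add: sum.distrib sum_subtractf sum_distrib_left W_def)
      also have "2 * s y * (\<Sum>i\<le>m. y i * w i) = (s y)\<^sup>2 * W"
        using W0 by (simp add: s_def power2_eq_square)
      finally show "R y \<in> usphere m" using y wz by (simp add: usphere_def R_def)
    qed
    fix y assume "(\<Sum>i\<le>m. y i * p i) = 0"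
    \<comment> \<open>For \<open>y\<close> orthogonal to \<open>p\<close> the inner product with
      \<open>w\<close> is \<open>- y m\<close>; together with the last entry of \<open>w\<close>
      this makes the correction cancel \<open>y m\<close>.\<close>
    then have "s y = - 2 * y m / W" by (simp add: s_def dot_w)
    moreover have "w m = - (W / 2)" unfolding W by (simp add: w_def field_simps)
    ultimately show "R y m = 0" using W0 by (simp add: R_def)
  qed
qed

section \<open>Parity of the degree and the Borsuk-Ulam theorem\<close>

lemma usphere_0: "usphere 0 = {\<lambda>i. if i = 0 then 1 else 0, \<lambda>i. if i = 0 then - 1 else 0}"
  by (auto simp: usphere_def power2_eq_1_iff fun_eq_iff)

theorem odd_degree_of_odd_map:
  assumes "n < CARD('v::finite)" "continuous_map (nsphere n) (nsphere n) f"
    and "\<And>x. x \<in> usphere n \<Longrightarrow> f (\<lambda>i. - x i) = (\<lambda>i. - f x i)"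
  shows "odd (Brouwer_degree2 n f)"
  using assms
proof (induction n arbitrary: f)
  case 0
  let ?e = "\<lambda>i::nat. if i = 0 then 1 else 0 :: real"
  have e: "?e \<in> usphere 0" by (simp add: usphere_0)
  have neg: "f (\<lambda>i. - ?e i) = (\<lambda>i. - f ?e i)" using 0(3)[OF e] .
  have fe: "f ?e \<in> usphere 0" using 0(2) e by (auto simp: continuous_map_nsphere_iff)
  have cases: "x = ?e \<or> x = (\<lambda>i. - ?e i)" if "x \<in> usphere 0" for x
    using that unfolding usphere_0 by (auto simp: fun_eq_iff)
  \<comment> \<open>The 0-sphere has two points, so an odd map is the identity or the reflection, of
    degree 1 or -1.\<close>
  from cases[OF fe] show ?case
  proof
    assume "f ?e = ?e"
    then have "f x = id x" if "x \<in> usphere 0" for x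
      using cases[OF that] neg by auto
    then have "Brouwer_degree2 0 f = Brouwer_degree2 0 id"
      by (intro Brouwer_degree2_eq) (simp add: topspace_nsphere)
    then show ?thesis by simp
  next
    assume a: "f ?e = (\<lambda>i. - ?e i)"
    have "f x = (\<lambda>i. if i = 0 then - x i else x i)" if "x \<in> usphere 0" for x
      using cases[OF that]
    proof
      assume "x = ?e"
      then show ?thesis using a by auto
    next
      assume "x = (\<lambda>i. - ?e i)"
      then show ?thesis using a neg by auto
    qed
    then have "Brouwer_degree2 0 f = Brouwer_degree2 0 (\<lambda>x i. if i = 0 then - x i else x i)"
      by (intro Brouwer_degree2_eq) (simp add: topspace_nsphere)
    then show ?thesis by (simp add: Brouwer_degree2_reflection)
  qed
next
  case (Suc n)
  define m where "m = Suc n"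
  have f: "continuous_on (usphere m) f" "f \<in> usphere m \<rightarrow> usphere m"
    using Suc.prems(2) by (simp_all add: continuous_map_nsphere_iff m_def)
  obtain g p where g: "continuous_on (usphere m) g"
    "\<And>x. x \<in> usphere m \<Longrightarrow> g (\<lambda>i. - x i) = (\<lambda>i. - g x i)"
    "\<And>x i. x \<in> usphere m \<Longrightarrow> i > m \<Longrightarrow> g x i = 0"
    "\<And>x. x \<in> usphere m \<Longrightarrow> (\<Sum>i\<le>m. (f x i - g x i)\<^sup>2) < 1"
    and p: "p \<in> usphere m" "\<And>x c. x \<in> usphere (m - 1) \<Longrightarrow> g x \<noteq> (\<lambda>i. c * p i)"
    using odd_smooth_approximation[of m f, where 'v = 'v] Suc.prems(1,3) f unfolding m_def by blast
  have n_m: "usphere n \<subseteq> usphere m" by (simp add: usphere_mono m_def)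
  have eq0: "f x i = 0" if "x \<in> usphere m" "i > m" for x i
    using f(2) that by (auto simp: usphere_def)
  \<comment> \<open>A zero on the segment would give \<open>f x = t * (f x - g x)\<close>
    coordinatewise, and the right side has norm below 1 while \<open>f x\<close> has norm 1.\<close>
  have seg: "\<exists>i\<le>m. (1 - t) * f x i + t * g x i \<noteq> 0" if x: "x \<in> usphere m" and t: "0 \<le> t" "t \<le> 1" for x t
  proof (rule ccontr)
    assume "\<not> ?thesis"
    then have "f x i = t * (f x i - g x i)" if "i \<le> m" for i using that by (auto simp: algebra_simps)
    then have "(\<Sum>i\<le>m. (f x i)\<^sup>2) = (\<Sum>i\<le>m. (t * (f x i - g x i))\<^sup>2)" by (intro sum.cong) auto
    also have "\<dots> = t\<^sup>2 * (\<Sum>i\<le>m. (f x i - g x i)\<^sup>2)" by (simp add: power_mult_distrib sum_distrib_left)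
    also have "\<dots> \<le> 1 * (\<Sum>i\<le>m. (f x i - g x i)\<^sup>2)"
      using t by (intro mult_right_mono) (auto simp: power_le_one sum_nonneg)
    also have "\<dots> < 1" using g(4)[OF x] by simp
    finally have "(\<Sum>i\<le>m. (f x i)\<^sup>2) < 1" .
    moreover have "f x \<in> usphere m" using f(2) x by auto
    ultimately show False by (simp add: usphere_def)
  qed
  have g_nz: "\<exists>i\<le>m. g x i \<noteq> 0" if "x \<in> usphere m" for x using seg[OF that, of 1] by simp
  text \<open>\<open>G\<close> agrees with \<open>g\<close> up to a multiple of \<open>p\<close> and is orthogonal to \<open>p\<close> on the equator. The homotopy
    from \<open>g\<close> to \<open>G\<close> could vanish only where \<open>g\<close> meets the line of \<open>p\<close> on the equator.\<close>
  define a where "a x = (\<Sum>i\<le>m. g x i * p i)" for x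
  define G where "G x = (\<lambda>i. g x i - (1 - \<bar>x m\<bar>) * a x * p i)" for x
  have cont_a: "continuous_on (usphere m) a"
    unfolding a_def by (intro continuous_intros continuous_on_product_then_coordinatewise[OF g(1)])
  have cont_G: "continuous_on (usphere m) G"
    unfolding G_def
    by (intro continuous_on_coordinatewise_then_product continuous_intros cont_a
        continuous_on_product_then_coordinatewise[OF g(1)] continuous_on_subset[OF continuous_on_product_coordinates]) auto
  have G0: "G x i = 0" if "x \<in> usphere m" "i > m" for x i
    using g(3)[OF that] p(1) that by (simp add: G_def usphere_def)
  have seg2: "\<exists>i\<le>m. (1 - t) * g x i + t * G x i \<noteq> 0" if x: "x \<in> usphere m" and t: "0 \<le> t" "t \<le> 1" for x t
  proof (rule ccontr)
    assume "\<not> ?thesis"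
    then have "g x i = (t * (1 - \<bar>x m\<bar>) * a x) * p i" if "i \<le> m" for i
      using that by (auto simp: G_def algebra_simps)
    moreover have "g x i = (t * (1 - \<bar>x m\<bar>) * a x) * p i" if "i > m" for i
      using g(3)[OF x that] p(1) that by (simp add: usphere_def)
    ultimately have gx: "g x = (\<lambda>i. (t * (1 - \<bar>x m\<bar>) * a x) * p i)" by (meson ext not_less)
    have ax: "a x = t * (1 - \<bar>x m\<bar>) * a x"
      using usphere_dot_eq_0[OF g(3)[OF x] p(1) gx] unfolding a_def[of x, symmetric] .
    have "a x \<noteq> 0" using g_nz[OF x] gx by auto
    \<comment> \<open>The product is at most \<open>1 - \<bar>x m\<bar>\<close>, or nonpositive if
      \<open>\<bar>x m\<bar>\<close> exceeds 1. It can equal 1 only for \<open>x m = 0\<close>, that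
      is, on the equator.\<close>
    then have "t * (1 - \<bar>x m\<bar>) = 1" using ax by simp
    moreover have "t * (1 - \<bar>x m\<bar>) \<le> 1 - \<bar>x m\<bar>" if "\<bar>x m\<bar> \<le> 1"
      using t that mult_right_mono[of t 1 "1 - \<bar>x m\<bar>"] by simp
    moreover have "t * (1 - \<bar>x m\<bar>) \<le> 0" if "\<not> \<bar>x m\<bar> \<le> 1"
      using t that by (simp add: mult_nonneg_nonpos)
    ultimately have "x m = 0" by linarith
    then have "x \<in> usphere n"
      using topspace_nsphere_minus1[of x m] x by (simp add: topspace_nsphere m_def)
    then have "x \<in> usphere (m - 1)" by (simp add: m_def)
    from p(2)[OF this] gx show False by (rule notE)
  qed
  have "homotopic_with (\<lambda>_. True) (nsphere m) (nsphere m) (\<lambda>x. radial m (f x)) (\<lambda>x. radial m (g x))"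
    by (rule homotopic_radial) (use f(1) eq0 g(1,3) seg in auto)
  moreover have "homotopic_with (\<lambda>_. True) (nsphere m) (nsphere m) (\<lambda>x. radial m (g x)) (\<lambda>x. radial m (G x))"
    by (rule homotopic_radial) (use cont_G G0 g(1,3) seg2 in auto)
  ultimately have hom: "Brouwer_degree2 m (\<lambda>x. radial m (f x)) = Brouwer_degree2 m (\<lambda>x. radial m (G x))"
    by (metis Brouwer_degree2_homotopic)
  have deg_f: "Brouwer_degree2 m f = Brouwer_degree2 m (\<lambda>x. radial m (G x))"
    unfolding hom[symmetric] using funcset_mem[OF f(2)]
    by (intro Brouwer_degree2_eq) (simp add: topspace_nsphere radial_usphere)
  have G_nz: "\<exists>i\<le>m. G x i \<noteq> 0" if "x \<in> usphere m" for x using seg2[OF that, of 1] by simp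
  have G_neg: "G (\<lambda>i. - x i) = (\<lambda>i. - G x i)" if "x \<in> usphere m" for x
    using g(2)[OF that] by (simp add: G_def a_def sum_negf algebra_simps)
  have contH: "continuous_map (nsphere m) (nsphere m) (\<lambda>x. radial m (G x))"
    unfolding continuous_map_nsphere_iff
    using continuous_on_radial[OF cont_G G_nz] radial_in_usphere[OF G_nz G0] by auto
  obtain R where R: "continuous_on UNIV R" "R \<in> usphere m \<rightarrow> usphere m"
    "\<And>y. R (\<lambda>i. - y i) = (\<lambda>i. - R y i)" "\<And>y. (\<Sum>i\<le>m. y i * p i) = 0 \<Longrightarrow> R y m = 0"
    using reflection_to_equator[OF p(1)] by blast
  have contR: "continuous_map (nsphere m) (nsphere m) R"
    unfolding continuous_map_nsphere_iff using R(2) continuous_on_subset[OF R(1)] by auto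
  define k where "k = R \<circ> (\<lambda>x. radial m (G x))"
  have contk: "continuous_map (nsphere m) (nsphere m) k"
    unfolding k_def by (rule continuous_map_compose[OF contH contR])
  have k_neg: "k (\<lambda>i. - x i) = (\<lambda>i. - k x i)" if "x \<in> usphere m" for x
    using that by (simp add: k_def G_neg radial_uminus R(3))
  have k_eq: "k x \<in> usphere n" if x: "x \<in> usphere n" for x
  proof -
    have x': "x \<in> usphere m" using x n_m by auto
    \<comment> \<open>On the equator the factor \<open>1 - \<bar>x m\<bar>\<close> is 1, so the full
      component along \<open>p\<close> is removed and \<open>R\<close> carries the result into the
      equator.\<close>
    have "x m = 0" using x by (simp add: usphere_def m_def)
    then have "(\<Sum>i\<le>m. G x i * p i) = (\<Sum>i\<le>m. g x i * p i - a x * (p i)\<^sup>2)"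
      by (simp add: G_def power2_eq_square algebra_simps)
    also have "\<dots> = a x - a x * (\<Sum>i\<le>m. (p i)\<^sup>2)"
      unfolding sum_subtractf sum_distrib_left[symmetric] a_def[symmetric] ..
    finally have "(\<Sum>i\<le>m. G x i * p i) = a x - a x * (\<Sum>i\<le>m. (p i)\<^sup>2)" .
    then have "(\<Sum>i\<le>m. G x i * p i) = 0" using p(1) by (simp add: usphere_def)
    then have "(\<Sum>i\<le>m. radial m (G x) i * p i) = 0"
      by (simp add: radial_def flip: sum_divide_distrib)
    then have "k x m = 0" by (simp add: k_def R(4))
    moreover have "k x \<in> usphere m" using contk x' by (auto simp: continuous_map_nsphere_iff)
    ultimately show ?thesis
      using topspace_nsphere_minus1[of "k x" m] by (simp add: topspace_nsphere m_def)
  qed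
  have "continuous_map (nsphere n) (nsphere n) k"
    using contk k_eq continuous_on_subset[OF _ n_m] by (auto simp: continuous_map_nsphere_iff)
  then have "odd (Brouwer_degree2 n k)"
    using Suc.prems(1) k_neg n_m by (intro Suc.IH) auto
  moreover have "even (Brouwer_degree2 m k - Brouwer_degree2 (m - Suc 0) k)"
    by (rule Borsuk_odd_mapping_degree_step[OF contk])
      (use k_neg k_eq in \<open>auto simp: topspace_nsphere m_def\<close>)
  ultimately have "odd (Brouwer_degree2 m k)" by (simp add: m_def)
  \<comment> \<open>An odd product has odd factors, so the degree of \<open>R\<close> need not be
    computed.\<close>
  also have "Brouwer_degree2 m k = Brouwer_degree2 m R * Brouwer_degree2 m f"
    unfolding k_def deg_f by (rule Brouwer_degree2_compose[OF contH contR])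
  finally show ?case by (simp add: m_def)
qed

text \<open>An odd map into a lower sphere, viewed as a self-map of \<open>nsphere n\<close>, misses
  the last unit vector. Its degree is then 0, which is even.\<close>

theorem Borsuk_Ulam_nsphere:
  assumes "n < CARD('v::finite)" "continuous_map (nsphere n) (nsphere m) h"
    and "\<And>x. x \<in> usphere n \<Longrightarrow> h (\<lambda>i. - x i) = (\<lambda>i. - h x i)"
  shows "n \<le> m"
proof (rule ccontr)
  assume "\<not> n \<le> m"
  then have mn: "m < n" by simp
  have h: "continuous_map (nsphere n) (nsphere n) h"
    using assms(2) usphere_mono[of m n] mn by (auto simp: continuous_map_nsphere_iff)
  let ?e = "\<lambda>i. if i = n then 1 else 0 :: real"
  have "?e \<in> usphere n"
    by (simp add: usphere_def if_distrib[of "\<lambda>x. x\<^sup>2"] cong: if_cong)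
  moreover have "?e \<notin> h ` usphere n"
  proof
    assume "?e \<in> h ` usphere n"
    then have "?e \<in> usphere m" using assms(2) by (auto simp: continuous_map_nsphere_iff)
    then have "?e n = 0" using mn unfolding usphere_def by blast
    then show False by simp
  qed
  ultimately have "Brouwer_degree2 n h = 0"
    by (intro Brouwer_degree2_nonsurjective[OF h]) (auto simp: topspace_nsphere)
  then show False using odd_degree_of_odd_map[OF assms(1) h assms(3)] by simp
qed

section \<open>Genus and min-max eigenvalues\<close>

text \<open>The sphere lies in an infinite product of lines; it is a closed subset of the cube with
  sides \<open>{- 1..1}\<close>, which is compact by Tychonoff.\<close>

lemma compact_usphere: "compact (usphere n)"
proof -
  have "compactin (product_topology (\<lambda>_::nat. euclideanreal) UNIV) (PiE UNIV (\<lambda>_. {- 1..1}))"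
    by (simp add: compactin_PiE)
  then have "compact (PiE UNIV (\<lambda>_::nat. {- 1..1::real}))"
    by (simp add: euclidean_product_topology)
  moreover have "closed (usphere n)"
  proof -
    have "usphere n = {x. (\<Sum>i\<le>n. (x i)\<^sup>2) = 1} \<inter> (\<Inter>i\<in>{n<..}. {x. x i = 0})"
      by (auto simp: usphere_def)
    moreover have "closed {x :: nat \<Rightarrow> real. (\<Sum>i\<le>n. (x i)\<^sup>2) = 1}"
      by (intro closed_Collect_eq continuous_intros continuous_on_product_coordinates)
    moreover have "closed {x :: nat \<Rightarrow> real. x i = 0}" for i
      by (intro closed_Collect_eq continuous_intros continuous_on_product_coordinates)
    ultimately show ?thesis by (simp add: closed_Int closed_INT)
  qed
  moreover have "usphere n \<subseteq> PiE UNIV (\<lambda>_. {- 1..1})"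
  proof
    fix x assume x: "x \<in> usphere n"
    have "x i \<in> {- 1..1}" for i
    proof (cases "i \<le> n")
      case True
      have "(x i)\<^sup>2 \<le> (\<Sum>i\<le>n. (x i)\<^sup>2)" using True by (intro member_le_sum) auto
      then have "(x i)\<^sup>2 \<le> 1" using x by (simp add: usphere_def)
      then have "\<bar>x i\<bar> \<le> 1" by (simp add: abs_square_le_1)
      then show ?thesis by auto
    qed (use x in \<open>simp add: usphere_def\<close>)
    then show "x \<in> PiE UNIV (\<lambda>_. {- 1..1})" by auto
  qed
  ultimately show ?thesis by (metis compact_Int_closed inf.absorb_iff2)
qed

lemma usphere_nonempty: "usphere n \<noteq> {}"
  using in_topspace_nsphere[of n] by (auto simp: topspace_nsphere)

text \<open>Restriction to the coordinates in \<open>H\<close> is odd and never zero on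
  \<open>A\<close>, so normalising it gives an odd map to the sphere of dimension
  \<open>card H - 1\<close>.\<close>

lemma genus_le:
  fixes A :: "(real ^ 'v::finite) set"
  assumes "A \<noteq> {}" and H: "\<And>x. x \<in> A \<Longrightarrow> \<exists>i\<in>H. x $ i \<noteq> 0"
  shows "genus A \<le> enat (card H)"
proof -
  define m where "m = card H"
  have "H \<noteq> {}" using assms by auto
  then have m: "1 \<le> m" by (simp add: m_def Suc_le_eq card_gt_0_iff)
  obtain c where c: "bij_betw c {0..<m} H" using ex_bij_betw_nat_finite[of H] by (auto simp: m_def)
  define y where "y x = (\<lambda>i. if i < m then x $ c i else 0)" for x :: "real ^ 'v"
  have nz: "\<exists>i\<le>m - 1. y x i \<noteq> 0" if x: "x \<in> A" for x
  proof -
    obtain v where v: "v \<in> H" "x $ v \<noteq> 0" using H[OF x] by auto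
    then obtain i where "i < m" "c i = v" using c by (auto simp: bij_betw_def)
    then show ?thesis using v by (intro exI[of _ i]) (auto simp: y_def)
  qed
  have y0: "y x i = 0" if "i > m - 1" for x i using that by (auto simp: y_def)
  have "continuous_on A y"
    unfolding y_def
  proof (rule continuous_on_coordinatewise_then_product)
    fix i show "continuous_on A (\<lambda>x. if i < m then x $ c i else 0)"
      by (cases "i < m") (simp_all add: continuous_on_component continuous_on_id)
  qed
  then have "continuous_map (top_of_set A) (nsphere (m - 1)) (\<lambda>x. radial (m - 1) (y x))"
    unfolding nsphere_eq_top_of_set
    using continuous_on_radial[OF _ nz] radial_in_usphere[OF nz y0] by auto
  moreover have "radial (m - 1) (y (- x)) = (\<lambda>i. - radial (m - 1) (y x) i)" for x
  proof -
    have "y (- x) = (\<lambda>i. - y x i)" by (auto simp: y_def)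
    then show ?thesis by (simp add: radial_uminus)
  qed
  ultimately show ?thesis
    unfolding genus_def using assms(1) m
    by (simp add: m_def[symmetric]) (intro Inf_lower; blast)
qed

text \<open>An odd map from the image to a sphere, composed with \<open>q\<close>, is an odd map
  between spheres, to which Borsuk-Ulam applies.\<close>

lemma genus_odd_image_ge:
  fixes q :: "(nat \<Rightarrow> real) \<Rightarrow> 'a::real_normed_vector"
  assumes "1 \<le> k" "k \<le> CARD('v::finite)" and q: "continuous_on (usphere (k - 1)) q"
    and odd: "\<And>x. x \<in> usphere (k - 1) \<Longrightarrow> q (\<lambda>i. - x i) = - q x"
  shows "enat k \<le> genus (q ` usphere (k - 1))"
proof -
  let ?A = "q ` usphere (k - 1)"
  have "k \<le> m" if m: "1 \<le> m" and h: "continuous_map (top_of_set ?A) (nsphere (m - 1)) h"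
    "\<forall>x\<in>?A. h (- x) = (\<lambda>i. - h x i)" for m h
  proof -
    have "continuous_map (nsphere (k - 1)) (top_of_set ?A) q"
      using q by (auto simp: nsphere_eq_top_of_set)
    then have "continuous_map (nsphere (k - 1)) (nsphere (m - 1)) (h \<circ> q)"
      using h(1) by (rule continuous_map_compose)
    moreover have "(h \<circ> q) (\<lambda>i. - x i) = (\<lambda>i. - (h \<circ> q) x i)" if "x \<in> usphere (k - 1)" for x
      using h(2) that by (simp add: odd)
    moreover have "k - 1 < CARD('v)" using assms(1,2) by simp
    ultimately have "k - 1 \<le> m - 1" using Borsuk_Ulam_nsphere[where 'v = 'v] by blast
    then show ?thesis using m by simp
  qed
  note bound = this
  have "?A \<noteq> {}" by (simp add: usphere_nonempty)
  show ?thesis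
    unfolding genus_def if_not_P[OF \<open>?A \<noteq> {}\<close>]
  proof (rule Inf_greatest)
    fix e assume "e \<in> {enat m |m. 1 \<le> m \<and>
       (\<exists>h. continuous_map (top_of_set ?A) (nsphere (m - 1)) h \<and> (\<forall>x\<in>?A. h (- x) = (\<lambda>i. - h x i)))}"
    then obtain m h where e: "e = enat m" and mh: "1 \<le> m" "continuous_map (top_of_set ?A) (nsphere (m - 1)) h"
      "\<forall>x\<in>?A. h (- x) = (\<lambda>i. - h x i)" by (elim CollectE exE conjE) (rule that)
    from bound[OF mh] show "enat k \<le> e" by (simp add: e)
  qed
qed

section \<open>The seminorm \<open>I_plus\<close> on spans of signed indicators\<close>

lemma I_plus_nonneg: "0 \<le> I_plus E x"
  by (simp add: I_plus_def sum_nonneg)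

lemma I_plus_scaleR: "I_plus E (c *\<^sub>R x) = \<bar>c\<bar> * I_plus E x"
  by (simp add: I_plus_def sum_distrib_left abs_mult flip: sum_distrib_left)

lemma wnorm_scaleR: "wnorm E (c *\<^sub>R x) = \<bar>c\<bar> * wnorm E x"
  by (simp add: wnorm_def sum_distrib_left abs_mult mult_ac)

lemma I_plus_add_le: "I_plus E (x + y) \<le> I_plus E x + I_plus E y"
  unfolding I_plus_def sum.distrib[symmetric]
  by (intro sum_mono) (simp add: sum.distrib abs_triangle_ineq)

lemma I_plus_sum_le: "finite J \<Longrightarrow> I_plus E (\<Sum>j\<in>J. f j) \<le> (\<Sum>j\<in>J. I_plus E (f j))"
proof (induction J rule: finite_induct)
  case (insert j J)
  then show ?case using I_plus_add_le[of E "f j" "sum f J"] by simp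
qed (simp add: I_plus_def)

lemma continuous_on_I_plus: "continuous_on S (I_plus E)"
  unfolding I_plus_def by (intro continuous_intros)

lemma abs_sum_disjoint_support:
  fixes a :: "'b \<Rightarrow> real"
  assumes "finite J" "\<And>i j. i \<in> J \<Longrightarrow> j \<in> J \<Longrightarrow> i \<noteq> j \<Longrightarrow> a i = 0 \<or> a j = 0"
  shows "\<bar>\<Sum>j\<in>J. a j\<bar> = (\<Sum>j\<in>J. \<bar>a j\<bar>)"
proof (cases "\<exists>i\<in>J. a i \<noteq> 0")
  case True
  then obtain i where i: "i \<in> J" "a i \<noteq> 0" by auto
  then have "\<forall>j\<in>J - {i}. a j = 0" using assms(2) by blast
  then show ?thesis using i(1) assms(1) by (simp add: sum.remove[of J i])
qed simp

text \<open>On combinations of signed indicators with disjoint supports \<open>wnorm\<close> is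
  additive while \<open>I_plus\<close> is subadditive. The bound for each indicator therefore passes
  to their whole span.\<close>

lemma competitor_exists:
  fixes E :: "'v::finite set set"
  assumes G: "simple_graph E" and iso: "\<forall>i. \<not> isolated E i" and k: "1 \<le> k" "k \<le> CARD('v)"
  obtains A where "A \<subseteq> X E" "compact A" "A = uminus ` A" "enat k \<le> genus A"
    "\<And>x. x \<in> A \<Longrightarrow> I_plus E x \<le> 1 - h_plus E k"
proof -
  obtain V where V: "admissible k V" and
    hV: "\<And>i. i \<in> {1..k} \<Longrightarrow> h_plus E k \<le> ratio E (V (2 * i - 1)) (V (2 * i))"
    using h_plus_attained[OF k] by blast
  \<comment> \<open>The index runs from 0 here: \<open>j\<close> stands for pair number
    \<open>j + 1\<close> of the family.\<close>
  define P Q where "P j = V (2 * j + 1)" and "Q j = V (2 * j + 2)" for j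
  define u where "u j = sign_vec (P j) (Q j)" for j
  have disj: "V m \<inter> V n = {}" if "m \<in> {1..2 * k}" "n \<in> {1..2 * k}" "m \<noteq> n" for m n
    using V that by (simp add: admissible_def disjoint_family_on_def)
  have PQ: "P j \<inter> Q j = {}" if "j < k" for j
    unfolding P_def Q_def using that by (intro disj) auto
  have ne: "P j \<union> Q j \<noteq> {}" if "j < k" for j
  proof -
    have "Suc j \<in> {1..k}" using that by simp
    then show ?thesis using V unfolding admissible_def P_def Q_def by fastforce
  qed
  have wu: "wnorm E (u j) = real (vol E (P j \<union> Q j))" if "j < k" for j
    unfolding u_def by (rule wnorm_sign_vec[OF PQ[OF that]])
  have wu_pos: "0 < wnorm E (u j)" if "j < k" for j
    using vol_pos[OF iso ne[OF that]] wu[OF that] by simp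
  have Iu: "I_plus E (u j) \<le> (1 - h_plus E k) * wnorm E (u j)" if j: "j < k" for j
  proof -
    have "h_plus E k \<le> ratio E (P j) (Q j)" using hV[of "Suc j"] j by (simp add: P_def Q_def)
    then have "h_plus E k * wnorm E (u j) \<le> 2 * real (card (edges_between E (P j) (Q j)))"
      using wu_pos[OF j] unfolding ratio_def wu[OF j] by (simp add: pos_le_divide_eq)
    then show ?thesis
      using I_plus_sign_vec[OF G PQ[OF j]] wu[OF j] by (simp add: u_def algebra_simps)
  qed
  have supp: "u i $ v = 0 \<or> u j $ v = 0" if "i < k" "j < k" "i \<noteq> j" for i j v
  proof -
    have "V m \<inter> V n = {}" if "m \<in> {2 * i + 1, 2 * i + 2}" "n \<in> {2 * j + 1, 2 * j + 2}" for m n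
      using that \<open>i < k\<close> \<open>j < k\<close> \<open>i \<noteq> j\<close> by (intro disj; auto; presburger)
    then have "(P i \<union> Q i) \<inter> (P j \<union> Q j) = {}" unfolding P_def Q_def by auto
    then show ?thesis by (auto simp: u_def sign_vec_def)
  qed
  define y where "y x = (\<Sum>j<k. x j *\<^sub>R u j)" for x :: "nat \<Rightarrow> real"
  have wy: "wnorm E (y x) = (\<Sum>j<k. \<bar>x j\<bar> * wnorm E (u j))" for x
  proof -
    have "\<bar>\<Sum>j<k. x j * u j $ v\<bar> = (\<Sum>j<k. \<bar>x j * u j $ v\<bar>)" for v
    proof (rule abs_sum_disjoint_support)
      fix i j assume "i \<in> {..<k}" "j \<in> {..<k}" "i \<noteq> j"
      then show "x i * u i $ v = 0 \<or> x j * u j $ v = 0" using supp[of i j v] by auto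
    qed simp
    then have "\<bar>y x $ v\<bar> = (\<Sum>j<k. \<bar>x j\<bar> * \<bar>u j $ v\<bar>)" for v
      by (simp add: y_def abs_mult)
    then have "wnorm E (y x) = (\<Sum>v\<in>UNIV. \<Sum>j<k. \<bar>x j\<bar> * (real (degree E v) * \<bar>u j $ v\<bar>))"
      by (simp add: wnorm_def sum_distrib_left mult_ac)
    also have "\<dots> = (\<Sum>j<k. \<bar>x j\<bar> * wnorm E (u j))"
      by (subst sum.swap) (simp add: wnorm_def sum_distrib_left)
    finally show ?thesis .
  qed
  have Iy: "I_plus E (y x) \<le> (1 - h_plus E k) * wnorm E (y x)" for x
  proof -
    have "I_plus E (y x) \<le> (\<Sum>j<k. \<bar>x j\<bar> * I_plus E (u j))"
      unfolding y_def using I_plus_sum_le[of "{..<k}" E "\<lambda>j. x j *\<^sub>R u j"] by (simp add: I_plus_scaleR)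
    also have "\<dots> \<le> (\<Sum>j<k. \<bar>x j\<bar> * ((1 - h_plus E k) * wnorm E (u j)))"
      by (intro sum_mono mult_left_mono Iu) auto
    also have "\<dots> = (1 - h_plus E k) * wnorm E (y x)" by (simp add: wy sum_distrib_left mult_ac)
    finally show ?thesis .
  qed
  have wy_pos: "0 < wnorm E (y x)" if x: "x \<in> usphere (k - 1)" for x
  proof -
    have "\<exists>j<k. x j \<noteq> 0"
    proof (rule ccontr)
      assume "\<not> ?thesis"
      then have "(\<Sum>i\<le>k - 1. (x i)\<^sup>2) = 0" using k(1) by (intro sum.neutral) auto
      then show False using x by (simp add: usphere_def)
    qed
    then obtain j where j: "j < k" "x j \<noteq> 0" by auto
    have "0 < \<bar>x j\<bar> * wnorm E (u j)" using j wu_pos by simp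
    also have "\<dots> \<le> wnorm E (y x)"
      unfolding wy using j(1) wu_pos by (intro member_le_sum) (auto simp: less_imp_le)
    finally show ?thesis .
  qed
  \<comment> \<open>Dividing by the norm, which is positive on the sphere, moves the linear image
    into \<open>X E\<close> and keeps the map odd.\<close>
  define q where "q x = (1 / wnorm E (y x)) *\<^sub>R y x" for x
  have y_neg: "y (\<lambda>i. - x i) = - y x" for x by (simp add: y_def sum_negf)
  have "wnorm E (- z) = wnorm E z" for z by (simp add: wnorm_def)
  then have q_neg: "q (\<lambda>i. - x i) = - q x" for x by (simp add: q_def y_neg)
  have cont_y: "continuous_on S y" for S
    unfolding y_def
    by (intro continuous_intros continuous_on_subset[OF continuous_on_product_coordinates]) auto
  have "continuous_on S (\<lambda>x. wnorm E (y x))" for S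
    unfolding wnorm_def by (intro continuous_intros cont_y)
  then have cont_q: "continuous_on (usphere (k - 1)) q"
    unfolding q_def using wy_pos by (intro continuous_intros cont_y) (auto simp: less_imp_neq[symmetric])
  have wq: "wnorm E (q x) = 1" if "x \<in> usphere (k - 1)" for x
    using wy_pos[OF that] by (simp add: q_def wnorm_scaleR)
  let ?A = "q ` usphere (k - 1)"
  show ?thesis
  proof (rule that[of ?A])
    show "?A \<subseteq> X E" using wq by (auto simp: X_def wnorm_def)
    show "compact ?A" by (rule compact_continuous_image[OF cont_q compact_usphere])
    show "?A = uminus ` ?A"
    proof -
      have "- q x \<in> ?A" if "x \<in> usphere (k - 1)" for x
        using q_neg[of x] uminus_usphere[OF that] by (metis imageI)
      then have sub: "uminus ` ?A \<subseteq> ?A" by auto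
      have "?A \<subseteq> uminus ` ?A"
      proof
        fix z assume "z \<in> ?A"
        then have "- z \<in> ?A" using sub by auto
        then show "z \<in> uminus ` ?A" by (intro image_eqI[of _ _ "- z"]) auto
      qed
      then show ?thesis using sub by (rule subset_antisym)
    qed
    show "enat k \<le> genus ?A" by (rule genus_odd_image_ge[where 'v = 'v, OF k cont_q q_neg])
    fix z assume "z \<in> ?A"
    then obtain x where x: "x \<in> usphere (k - 1)" "z = q x" by auto
    have "I_plus E z = I_plus E (y x) / wnorm E (y x)"
      using wy_pos[OF x(1)] by (simp add: x(2) q_def I_plus_scaleR)
    also have "\<dots> \<le> 1 - h_plus E k" using Iy[of x] wy_pos[OF x(1)] by (simp add: pos_divide_le_eq)
    finally show "I_plus E z \<le> 1 - h_plus E k" .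
  qed
qed

theorem theorem3p9:
  fixes E :: "'v::finite set set" and n k :: nat
  assumes "forest E"
    and "\<forall>i. \<not> isolated E i"
    and "CARD('v) = n"
    and "1 \<le> k" and "k \<le> n"
  shows "minmax_eigenvalue E k = 1 - h_plus E k"
proof -
  have G: "simple_graph E" using assms(1) by (simp add: forest_def)
  define \<A> where "\<A> = {A. A \<subseteq> X E \<and> compact A \<and> A = uminus ` A \<and> enat k \<le> genus A}"
  have \<A>D: "A \<subseteq> X E" "compact A" "enat k \<le> genus A" if "A \<in> \<A>" for A
    using that unfolding \<A>_def by blast+
  \<comment> \<open>The empty set has genus 0 and \<open>k\<close> is positive. Nonemptiness and the
    boundedness shown next make the real supremum meaningful.\<close>
  have ne: "A \<noteq> {}" if "A \<in> \<A>" for A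
  proof
    assume "A = {}"
    then have "enat k \<le> 0" using \<A>D(3)[OF that] by (simp add: genus_def)
    then show False using assms(4) by (simp add: zero_enat_def)
  qed
  have bdd: "bdd_above (I_plus E ` A)" if "A \<in> \<A>" for A
    by (intro bounded_imp_bdd_above compact_imp_bounded compact_continuous_image
        continuous_on_I_plus \<A>D(2)[OF that])
  have sup_nonneg: "0 \<le> (SUP x\<in>A. I_plus E x)" if A: "A \<in> \<A>" for A
  proof -
    obtain x where "x \<in> A" using ne[OF A] by auto
    then show ?thesis using I_plus_nonneg[of E x] cSUP_upper[OF _ bdd[OF A]] by (rule_tac order_trans)
  qed
  have kn: "k \<le> CARD('v)" using assms(3,5) by simp
  obtain A0 where A0: "A0 \<in> \<A>" "\<And>x. x \<in> A0 \<Longrightarrow> I_plus E x \<le> 1 - h_plus E k"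
    by (rule competitor_exists[OF G assms(2,4) kn]) (rule that, unfold \<A>_def, intro CollectI conjI)
  have "(INF A\<in>\<A>. SUP x\<in>A. I_plus E x) \<le> (SUP x\<in>A0. I_plus E x)"
    using sup_nonneg by (intro cINF_lower A0(1) bdd_belowI2)
  also have "\<dots> \<le> 1 - h_plus E k" by (rule cSUP_least[OF ne[OF A0(1)] A0(2)])
  finally have upper: "(INF A\<in>\<A>. SUP x\<in>A. I_plus E x) \<le> 1 - h_plus E k" .
  have lower: "1 - h_plus E k \<le> (INF A\<in>\<A>. SUP x\<in>A. I_plus E x)"
  proof (rule cINF_greatest)
    show "\<A> \<noteq> {}" using A0(1) by auto
    fix A assume A: "A \<in> \<A>"
    show "1 - h_plus E k \<le> (SUP x\<in>A. I_plus E x)"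
    proof (rule ccontr)
      assume "\<not> ?thesis"
      \<comment> \<open>Taking \<theta> to be 1 minus the supremum, every point of \<open>A\<close>
        satisfies the bound in \<open>small_hitting_set\<close>. Fewer than \<open>k\<close>
        coordinates then suffice to detect all of \<open>A\<close>, against its genus.\<close>
      then have "h_plus E k < 1 - (SUP x\<in>A. I_plus E x)" by simp
      from small_hitting_set[OF assms(1,2,4) this] obtain H where "card H < k" and
        H: "\<And>x. x \<in> X E \<Longrightarrow> I_plus E x \<le> (SUP x\<in>A. I_plus E x) \<Longrightarrow> \<exists>i\<in>H. x $ i \<noteq> 0"
        by auto
      have "\<exists>i\<in>H. x $ i \<noteq> 0" if "x \<in> A" for x
        using \<A>D(1)[OF A] that by (intro H cSUP_upper bdd A) auto
      then have "genus A \<le> enat (card H)" by (rule genus_le[OF ne[OF A]])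
      moreover have "enat k \<le> genus A" by (rule \<A>D(3)[OF A])
      ultimately have "enat k \<le> enat (card H)" by (rule order_trans[rotated])
      then show False using \<open>card H < k\<close> by simp
    qed
  qed
  show ?thesis using upper lower unfolding minmax_eigenvalue_def \<A>_def by simp
qed

end
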